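(* Let $\mathcal{H}$ be a real separable Hilbert space, let $A,B$ be self-adjoint operators on $\mathcal{H}$ such that $A+B$ and $A-B$ are positive invertible and commute with each other, and let $S=\begin{bmatrix} A & B \\ B & A \end{bmatrix}$ on $\mathcal{H}\oplus\mathcal{H}$. Then $S$ is a Gaussian Covariance Operator if and only if all of the following hold: 1. $\widehat{A+B}\ge(\widehat{A-B})^{-1}$ on $\hat{\mathcal{H}}$; 2. $A+B-I$ and $A-B-I$ are Hilbert-Schmidt operators on $\mathcal{H}$; 3. $A^2-B^2-I$ is a trace class operator on $\mathcal{H}$.
   Context: Operators are bounded and linear. For a real Hilbert space $\mathcal{K}$, $\hat{\mathcal{K}}=\mathcal{K}+i\mathcal{K}$ is its complexification, and for an operator $T$ on $\mathcal{K}$, $\hat T(x+iy)=Tx+iTy$ is the complexification of $T$ on $\hat{\mathcal{K}}$ (also written $\widehat{T}$). The spectrum of $T$ is the spectrum of $\hat T$. An operator on a real Hilbert space is positive invertible if it is self-adjoint and its spectrum is contained in $(0,\infty)$. On $\mathcal{H}\oplus\mathcal{H}$ let $J=\begin{bmatrix} 0 & I \\ -I & 0 \end{bmatrix}$. A real linear, bounded, symmetric and invertible operator $S$ on $\mathcal{H}\oplus\mathcal{H}$ is a Gaussian Covariance Operator (GCO) if: (i) $\hat S-i\hat J\ge 0$; (ii) $S-I$ is Hilbert-Schmidt; (iii) $(\sqrt S J\sqrt S)^T(\sqrt SJ\sqrt S)-I$ is of trace class. (Condition (i) forces $S\geq 0$, so $\sqrt S$ makes sense.) *)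

theory Defs
  imports "HOL-Analysis.Analysis"
begin

section \<open>Bounded operators on a real Hilbert space\<close>

definition self_adjoint :: "('a::real_inner \<Rightarrow>\<^sub>L 'a) \<Rightarrow> bool" where
  "self_adjoint T \<longleftrightarrow> (\<forall>x y. T x \<bullet> y = x \<bullet> T y)"

definition positive_op :: "('a::real_inner \<Rightarrow>\<^sub>L 'a) \<Rightarrow> bool" where
  "positive_op T \<longleftrightarrow> self_adjoint T \<and> (\<forall>x. 0 \<le> T x \<bullet> x)"

definition is_op_inverse ::
    "('a::real_normed_vector \<Rightarrow>\<^sub>L 'a) \<Rightarrow> ('a \<Rightarrow>\<^sub>L 'a) \<Rightarrow> bool" where
  "is_op_inverse T R \<longleftrightarrow> T o\<^sub>L R = id_blinfun \<and> R o\<^sub>L T = id_blinfun"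

definition op_invertible :: "('a::real_normed_vector \<Rightarrow>\<^sub>L 'a) \<Rightarrow> bool" where
  "op_invertible T \<longleftrightarrow> (\<exists>R. is_op_inverse T R)"

definition op_inverse :: "('a::real_normed_vector \<Rightarrow>\<^sub>L 'a) \<Rightarrow> ('a \<Rightarrow>\<^sub>L 'a)" where
  "op_inverse T = (THE R. is_op_inverse T R)"

text \<open>On a Hilbert space every bounded operator has a (unique, bounded) adjoint, so
  \<open>adjoint\<close> is not underspecified here.\<close>

definition op_adjoint :: "('a::real_inner \<Rightarrow>\<^sub>L 'a) \<Rightarrow> ('a \<Rightarrow>\<^sub>L 'a)" where
  "op_adjoint T = Blinfun (adjoint (blinfun_apply T))"

text \<open>Meaningful when \<open>T\<close> is positive and the space is complete: the positive square root
  then exists and is unique.\<close>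

definition op_sqrt :: "('a::real_inner \<Rightarrow>\<^sub>L 'a) \<Rightarrow> ('a \<Rightarrow>\<^sub>L 'a)" where
  "op_sqrt T = (THE R. positive_op R \<and> R o\<^sub>L R = T)"

definition op_abs :: "('a::real_inner \<Rightarrow>\<^sub>L 'a) \<Rightarrow> ('a \<Rightarrow>\<^sub>L 'a)" where
  "op_abs T = op_sqrt (op_adjoint T o\<^sub>L T)"

definition orthonormal_basis :: "'a::real_inner set \<Rightarrow> bool" where
  "orthonormal_basis E \<longleftrightarrow>
     pairwise orthogonal E \<and> (\<forall>e\<in>E. norm e = 1) \<and> closure (span E) = UNIV"

text \<open>In the next two definitions the sum does not depend on the choice of the orthonormal
  basis, and every Hilbert space has one.\<close>

definition hilbert_schmidt :: "('a::real_inner \<Rightarrow>\<^sub>L 'a) \<Rightarrow> bool" where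
  "hilbert_schmidt T \<longleftrightarrow>
     (\<exists>E. orthonormal_basis E \<and> (\<lambda>e. (norm (T e))\<^sup>2) summable_on E)"

definition trace_class :: "('a::real_inner \<Rightarrow>\<^sub>L 'a) \<Rightarrow> bool" where
  "trace_class T \<longleftrightarrow>
     (\<exists>E. orthonormal_basis E \<and> (\<lambda>e. op_abs T e \<bullet> e) summable_on E)"


section \<open>Complexification\<close>

text \<open>The pair \<open>(x, y)\<close> stands for \<open>x + iy\<close>. The product norm is the Hilbert norm of the
  complexification, since \<open>norm (x + iy) ^ 2 = norm x ^ 2 + norm y ^ 2\<close>. Complex operators are
  represented by their underlying real-linear maps; complex multiplication is \<open>cmult\<close>.\<close>

type_synonym 'a complexification = "'a \<times> 'a"

definition cmult ::
    "complex \<Rightarrow> ('a::real_normed_vector) complexification \<Rightarrow>\<^sub>L 'a complexification" where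
  "cmult c = Blinfun (\<lambda>(x, y). (Re c *\<^sub>R x - Im c *\<^sub>R y, Im c *\<^sub>R x + Re c *\<^sub>R y))"

lemma cmult_apply [simp]:
  "cmult c (x, y) = (Re c *\<^sub>R x - Im c *\<^sub>R y, Im c *\<^sub>R x + Re c *\<^sub>R y)"
  unfolding cmult_def case_prod_unfold
  by (subst bounded_linear_Blinfun_apply) (intro bounded_linear_intros, simp)

definition complexify ::
    "('a::real_normed_vector \<Rightarrow>\<^sub>L 'a) \<Rightarrow> ('a complexification \<Rightarrow>\<^sub>L 'a complexification)" where
  "complexify T = Blinfun (\<lambda>(x, y). (T x, T y))"

lemma complexify_apply [simp]: "complexify T (x, y) = (T x, T y)"
  unfolding complexify_def case_prod_unfold
  by (subst bounded_linear_Blinfun_apply) (intro bounded_linear_intros, simp)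

text \<open>The Hermitian inner product extending the real one, linear in the first argument.\<close>

definition cinner :: "('a::real_inner) complexification \<Rightarrow> 'a complexification \<Rightarrow> complex" where
  "cinner z w =
     Complex (fst z \<bullet> fst w + snd z \<bullet> snd w) (snd z \<bullet> fst w - fst z \<bullet> snd w)"

definition cpositive ::
    "(('a::real_inner) complexification \<Rightarrow>\<^sub>L 'a complexification) \<Rightarrow> bool" where
  "cpositive T \<longleftrightarrow> (\<forall>z. Im (cinner (T z) z) = 0 \<and> 0 \<le> Re (cinner (T z) z))"

definition cop_le ::
    "(('a::real_inner) complexification \<Rightarrow>\<^sub>L 'a complexification) \<Rightarrow>
     ('a complexification \<Rightarrow>\<^sub>L 'a complexification) \<Rightarrow> bool" where
  "cop_le T U \<longleftrightarrow> cpositive (U - T)"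

text \<open>A two-sided real-linear inverse of a complex-linear operator is complex-linear, so
  \<open>op_invertible\<close> here is invertibility among the bounded complex-linear operators.\<close>

definition spectrum :: "('a::real_normed_vector \<Rightarrow>\<^sub>L 'a) \<Rightarrow> complex set" where
  "spectrum T = {l. \<not> op_invertible (complexify T - cmult l)}"

definition positive_invertible :: "('a::real_inner \<Rightarrow>\<^sub>L 'a) \<Rightarrow> bool" where
  "positive_invertible T \<longleftrightarrow> self_adjoint T \<and> spectrum T \<subseteq> complex_of_real ` {0<..}"


section \<open>Gaussian covariance operators\<close>

text \<open>The direct sum of two copies of \<open>'a\<close> is \<open>'a \<times> 'a\<close> with its product inner product.\<close>

definition block_op ::
    "('a::real_normed_vector \<Rightarrow>\<^sub>L 'a) \<Rightarrow> ('a \<Rightarrow>\<^sub>L 'a) \<Rightarrow> ('a \<Rightarrow>\<^sub>L 'a) \<Rightarrow> ('a \<Rightarrow>\<^sub>L 'a) \<Rightarrow>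
     (('a \<times> 'a) \<Rightarrow>\<^sub>L ('a \<times> 'a))" where
  "block_op A B C D = Blinfun (\<lambda>(x, y). (A x + B y, C x + D y))"

lemma block_op_apply [simp]: "block_op A B C D (x, y) = (A x + B y, C x + D y)"
  unfolding block_op_def case_prod_unfold
  by (subst bounded_linear_Blinfun_apply) (intro bounded_linear_intros, simp)

definition J_op :: "('a::real_normed_vector \<times> 'a) \<Rightarrow>\<^sub>L ('a \<times> 'a)" where
  "J_op = block_op 0 id_blinfun (- id_blinfun) 0"

definition gaussian_covariance_operator ::
    "(('a::real_inner \<times> 'a) \<Rightarrow>\<^sub>L ('a \<times> 'a)) \<Rightarrow> bool" where
  "gaussian_covariance_operator S \<longleftrightarrow>
     self_adjoint S \<and> op_invertible S \<and>
     cpositive (complexify S - (cmult \<i> o\<^sub>L complexify J_op)) \<and>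
     hilbert_schmidt (S - id_blinfun) \<and>
     (let K = op_sqrt S o\<^sub>L J_op o\<^sub>L op_sqrt S
      in trace_class ((op_adjoint K o\<^sub>L K) - id_blinfun))"

end

theory Submission
  imports Defs
begin

text \<open>Put \<open>P = A + B\<close>, \<open>Q = A - B\<close> and let \<open>V\<close> be the self-adjoint involution
  \<open>(x, y) \<mapsto> (x + y, x - y) / \<surd>2\<close>. Then \<open>S = V diag(P, Q) V\<close> and \<open>V J V = - J\<close>, so
  conjugation by \<open>V\<close> turns the three conditions into statements about \<open>diag(P, Q)\<close>: positivity says
  that \<open>2 \<langle>a, d\<rangle> \<le> \<langle>P a, a\<rangle> + \<langle>Q d, d\<rangle>\<close> for all \<open>a, d\<close>, and minimising over \<open>d\<close> gives
  \<open>P \<ge> Q\<^sup>-\<^sup>1\<close>; and since \<open>P\<close> and \<open>Q\<close> commute, the square roots recombine to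
  \<open>K\<^sup>T K = V diag(PQ, PQ) V\<close>, where \<open>PQ = A\<^sup>2 - B\<^sup>2\<close>.\<close>

section \<open>Positive operators and their square roots\<close>

text \<open>Several notions of the statement are given by \<open>THE\<close> or by an existential,
  and most of the work makes them computable. \<open>op_sqrt\<close> needs existence and uniqueness
  of positive roots; after that, every root and absolute value is found by exhibiting a candidate.
  \<open>hilbert_schmidt\<close> and \<open>trace_class\<close> only promise some orthonormal basis:
  the one for a block diagonal operator may be skew to the splitting, and those for \<open>P\<close>
  and \<open>Q\<close> may differ, so independence of the basis has to come first. Positivity of
  \<open>P\<close> and \<open>Q\<close> is hidden in a spectrum on the complexification and is
  recovered by a variational argument on the real space. The sign in \<open>V J V = - J\<close> does
  no harm: \<open>J\<close> enters the third condition twice, and in the first the sign is absorbed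
  by reversing one vector.\<close>

lemma blinfun_eq_iff: "f = g \<longleftrightarrow> (\<forall>x. blinfun_apply f x = blinfun_apply g x)"
  by (auto intro: blinfun_eqI)

lemma self_adjointD: "self_adjoint T \<Longrightarrow> T x \<bullet> y = x \<bullet> T y"
  by (simp add: self_adjoint_def)

lemma positive_opD:
  assumes "positive_op T"
  shows "self_adjoint T" "0 \<le> T x \<bullet> x"
  using assms by (auto simp: positive_op_def)

lemma self_adjoint_id: "self_adjoint id_blinfun"
  by (simp add: self_adjoint_def)

lemma self_adjoint_diff: "self_adjoint S \<Longrightarrow> self_adjoint T \<Longrightarrow> self_adjoint (S - T)"
  by (simp add: self_adjoint_def blinfun.bilinear_simps inner_simps)

lemma self_adjoint_compose:
  assumes "self_adjoint S" "self_adjoint T" "S o\<^sub>L T = T o\<^sub>L S"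
  shows "self_adjoint (S o\<^sub>L T)"
  unfolding self_adjoint_def
  using assms by (metis blinfun_apply_blinfun_compose self_adjointD)

lemma positive_op_square: "self_adjoint T \<Longrightarrow> positive_op (T o\<^sub>L T)"
  by (metis blinfun_apply_blinfun_compose inner_ge_zero positive_op_def self_adjoint_def)

text \<open>This is Cauchy-Schwarz for the semi-inner product defined by \<open>T\<close>, extracted
  from the form of \<open>T\<close> along the line through \<open>x\<close> in direction
  \<open>T x\<close>.\<close>

lemma positive_op_norm_sq_le:
  fixes T :: "'a::real_inner \<Rightarrow>\<^sub>L 'a"
  assumes "positive_op T"
  shows "(norm (T x))\<^sup>2 \<le> norm T * (T x \<bullet> x)"
proof -
  define y a b c where "y = T x" and "a = T x \<bullet> x" and "b = (norm y)\<^sup>2" and "c = T y \<bullet> y"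
  have nonneg: "0 \<le> a + 2 * t * b + t\<^sup>2 * c" for t
  proof -
    have "0 \<le> T (x + t *\<^sub>R y) \<bullet> (x + t *\<^sub>R y)"
      using assms by (rule positive_opD)
    also have "\<dots> = a + 2 * t * b + t\<^sup>2 * c"
      using self_adjointD[OF positive_opD(1)[OF assms], of y x]
      unfolding a_def b_def c_def y_def power2_norm_eq_inner
      by (simp add: blinfun.bilinear_simps inner_simps power2_eq_square inner_commute algebra_simps)
    finally show ?thesis .
  qed
  have a: "0 \<le> a" and b: "0 \<le> b"
    using nonneg[of 0] by (auto simp: b_def)
  have c: "c \<le> norm T * b"
  proof -
    have "c \<le> norm (T y) * norm y"
      unfolding c_def by (rule norm_cauchy_schwarz)
    also have "\<dots> \<le> (norm T * norm y) * norm y"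
      by (intro mult_right_mono norm_blinfun) simp
    finally show ?thesis by (simp add: b_def power2_eq_square mult.assoc)
  qed
  have "b \<le> norm T * a"
  proof (cases "norm T = 0")
    case True
    then show ?thesis using a by (simp add: b_def y_def)
  next
    case False
    then have T: "norm T > 0" by simp
    \<comment> \<open>The value \<open>- (1 / norm T)\<close> of \<open>t\<close> minimises the
      bound \<open>a + 2 * t * b + t^2 * (norm T * b)\<close>.\<close>
    have "0 \<le> a + 2 * (- (1 / norm T)) * b + (- (1 / norm T))\<^sup>2 * c"
      by (rule nonneg)
    also have "\<dots> \<le> a + 2 * (- (1 / norm T)) * b + (- (1 / norm T))\<^sup>2 * (norm T * b)"
      using c by (intro add_left_mono mult_left_mono) auto
    also have "\<dots> = a - b / norm T"
      using T by (simp add: field_simps power2_eq_square)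
    finally show ?thesis using T by (simp add: field_simps)
  qed
  then show ?thesis by (simp add: a_def b_def y_def)
qed

lemma positive_op_eq_0: "positive_op T \<Longrightarrow> T x \<bullet> x = 0 \<Longrightarrow> T x = 0"
  using positive_op_norm_sq_le[of T x] by simp

text \<open>The equation says \<open>(I - X)\<^sup>2 = I - Z\<close>. It is solved by iterating its right-hand side from
  \<open>0\<close>; the increments are dominated by those of the scalar iteration \<open>t \<mapsto> (1 + t\<^sup>2) / 2\<close>.\<close>

lemma contraction_quadratic_fixpoint:
  fixes Z :: "'a::{real_inner, complete_space} \<Rightarrow>\<^sub>L 'a"
  assumes Z: "norm Z \<le> 1" and sa: "self_adjoint Z"
  obtains X where "norm X \<le> 1" "X = (1/2) *\<^sub>R (Z + (X o\<^sub>L X))" "self_adjoint X"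
    "\<And>C. C o\<^sub>L Z = Z o\<^sub>L C \<Longrightarrow> C o\<^sub>L X = X o\<^sub>L C"
proof -
  define X where "X n = ((\<lambda>Y. (1/2) *\<^sub>R (Z + (Y o\<^sub>L Y))) ^^ n) 0" for n
  define s where "s n = ((\<lambda>t::real. (1 + t\<^sup>2) / 2) ^^ n) 0" for n
  have X0: "X 0 = 0" and XS: "X (Suc n) = (1/2) *\<^sub>R (Z + (X n o\<^sub>L X n))" for n
    by (simp_all add: X_def)
  have s0: "s 0 = 0" and sS: "s (Suc n) = (1 + (s n)\<^sup>2) / 2" for n
    by (simp_all add: s_def)
  have s01: "0 \<le> s n \<and> s n \<le> 1" for n
  proof (induction n)
    case (Suc n)
    then have "(s n)\<^sup>2 \<le> 1" by (simp add: power_le_one)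
    then show ?case by (simp add: sS)
  qed (simp add: s0)
  have s_mono: "s n \<le> s (Suc n)" for n
    using zero_le_power2[of "s n - 1"] by (simp add: sS power2_eq_square algebra_simps)
  have Xs: "norm (X n) \<le> s n" for n
  proof (induction n)
    case (Suc n)
    have "norm (X n o\<^sub>L X n) \<le> norm (X n) * norm (X n)"
      by (rule norm_blinfun_compose)
    also have "\<dots> \<le> s n * s n"
      using Suc s01[of n] by (intro mult_mono) auto
    finally have "norm (Z + (X n o\<^sub>L X n)) \<le> 1 + (s n)\<^sup>2"
      using Z norm_triangle_ineq[of Z "X n o\<^sub>L X n"] by (simp add: power2_eq_square)
    then show ?case by (simp add: XS sS)
  qed (simp add: X0 s0)
  have step: "norm (X (Suc n) - X n) \<le> s (Suc n) - s n" for n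
  proof (induction n)
    case 0
    then show ?case using Z by (simp add: XS X0 sS s0)
  next
    case (Suc n)
    let ?D = "X (Suc n) - X n"
    \<comment> \<open>A difference of squares that keeps the order of the factors:
      \<open>Y Y - X X = Y (Y - X) + (Y - X) X\<close>. The scalar version of it computes the
      increments of \<open>s\<close>.\<close>
    have eq: "X (Suc (Suc n)) - X (Suc n) = (1/2) *\<^sub>R ((X (Suc n) o\<^sub>L ?D) + (?D o\<^sub>L X n))"
    proof (rule blinfun_eqI)
      fix x
      have "X (Suc (Suc n)) x - X (Suc n) x
          = (1/2) *\<^sub>R (Z x + X (Suc n) (X (Suc n) x)) - (1/2) *\<^sub>R (Z x + X n (X n x))"
        by (simp only: XS[of "Suc n"] XS[of n] blinfun.bilinear_simps blinfun_apply_blinfun_compose)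
      also have "\<dots> = (1/2) *\<^sub>R (X (Suc n) (X (Suc n) x) - X n (X n x))"
        by (simp add: scaleR_add_right scaleR_diff_right)
      finally show "(X (Suc (Suc n)) - X (Suc n)) x
          = ((1/2) *\<^sub>R ((X (Suc n) o\<^sub>L ?D) + (?D o\<^sub>L X n))) x"
        by (simp add: blinfun.bilinear_simps)
    qed
    have "norm ((X (Suc n) o\<^sub>L ?D) + (?D o\<^sub>L X n)) \<le> norm (X (Suc n)) * norm ?D + norm ?D * norm (X n)"
      by (intro norm_triangle_le add_mono norm_blinfun_compose)
    also have "\<dots> \<le> s (Suc n) * (s (Suc n) - s n) + (s (Suc n) - s n) * s n"
      using Suc Xs s01 s_mono by (intro add_mono mult_mono) auto
    also have "\<dots> = 2 * (s (Suc (Suc n)) - s (Suc n))"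
      by (simp add: sS[of "Suc n"] sS[of n] power2_eq_square algebra_simps)
    finally show ?case by (simp add: eq)
  qed
  have diff: "norm (X (n + k) - X n) \<le> s (n + k) - s n" for n k
  proof (induction k)
    case (Suc k)
    have "norm (X (n + Suc k) - X n) \<le> norm (X (Suc (n + k)) - X (n + k)) + norm (X (n + k) - X n)"
      using norm_triangle_ineq[of "X (Suc (n + k)) - X (n + k)" "X (n + k) - X n"] by simp
    then show ?case using Suc step[of "n + k"] by simp
  qed simp
  have "incseq s" using s_mono by (rule incseq_SucI)
  then have "convergent s"
    using s01 by (intro Bseq_monoseq_convergent BseqI'[of _ 1]) (auto simp: incseq_imp_monoseq)
  then have s_Cauchy: "Cauchy s" by (rule convergent_Cauchy)
  \<comment> \<open>The limit operator is built vector by vector, so only Cauchy sequences in the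
    space itself occur. The 1 in \<open>norm x + 1\<close> covers \<open>x = 0\<close>.\<close>
  have "\<exists>l. (\<lambda>n. X n x) \<longlonglongrightarrow> l" for x
  proof -
    have "Cauchy (\<lambda>n. X n x)"
    proof (rule CauchyI')
      fix e :: real assume e: "0 < e"
      then have "0 < e / (norm x + 1)" by (simp add: add_nonneg_pos)
      from CauchyD[OF s_Cauchy this]
      obtain M where M: "\<And>m n. m \<ge> M \<Longrightarrow> n \<ge> M \<Longrightarrow> norm (s m - s n) < e / (norm x + 1)"
        by blast
      have "norm (X m x - X n x) < e" if "m \<ge> M" "n > m" for m n
      proof -
        have "norm (X m x - X n x) = norm ((X (m + (n - m)) - X m) x)"
          using that by (simp add: blinfun.bilinear_simps norm_minus_commute)
        also have "\<dots> \<le> norm (X (m + (n - m)) - X m) * norm x"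
          by (rule norm_blinfun)
        also have "\<dots> \<le> norm (s n - s m) * norm x"
          using diff[of m "n - m"] that by (intro mult_right_mono) auto
        also have "\<dots> \<le> norm (s n - s m) * (norm x + 1)"
          by (intro mult_left_mono) auto
        also have "\<dots> < e"
          using M[of n m] that by (simp add: pos_less_divide_eq add_nonneg_pos)
        finally show ?thesis .
      qed
      then show "\<exists>M. \<forall>m\<ge>M. \<forall>n>m. dist (X m x) (X n x) < e" by (auto simp: dist_norm)
    qed
    then show ?thesis using Cauchy_convergent convergent_def by blast
  qed
  then obtain v where v: "\<And>x. (\<lambda>n. X n x) \<longlonglongrightarrow> v x" by metis
  have X1: "norm (X n x) \<le> norm x" for n x
  proof -
    have "norm (X n x) \<le> norm (X n) * norm x" by (rule norm_blinfun)
    also have "\<dots> \<le> 1 * norm x"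
      using Xs[of n] s01[of n] by (intro mult_right_mono) auto
    finally show ?thesis by simp
  qed
  have v1: "norm (v x) \<le> norm x" for x
    by (rule LIMSEQ_le_const2[OF tendsto_norm[OF v]]) (use X1 in auto)
  have bl: "bounded_linear v"
  proof (rule bounded_linear_intro[where K = 1])
    fix x y and r :: real
    show "v (x + y) = v x + v y"
      by (rule LIMSEQ_unique[OF v]) (simp add: blinfun.bilinear_simps tendsto_add v)
    show "v (r *\<^sub>R x) = r *\<^sub>R v x"
      by (rule LIMSEQ_unique[OF v]) (simp add: blinfun.bilinear_simps tendsto_scaleR v)
    show "norm (v x) \<le> norm x * 1" using v1 by simp
  qed
  define L where "L = Blinfun v"
  have L: "(\<lambda>n. X n x) \<longlonglongrightarrow> L x" for x
    using v by (simp add: L_def bounded_linear_Blinfun_apply[OF bl])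
  \<comment> \<open>Pointwise convergence survives squaring because all iterates are contractions:
    the error \<open>X n (X n x - L x)\<close> is no longer than \<open>X n x - L x\<close>.\<close>
  have L2: "(\<lambda>n. X n (X n x)) \<longlonglongrightarrow> L (L x)" for x
  proof -
    have "(\<lambda>n. X n (X n x - L x)) \<longlonglongrightarrow> 0"
    proof (rule Lim_null_comparison)
      show "\<forall>\<^sub>F n in sequentially. norm (X n (X n x - L x)) \<le> norm (X n x - L x)"
        using X1 by simp
      show "(\<lambda>n. norm (X n x - L x)) \<longlonglongrightarrow> 0"
        using L[of x] by (simp add: LIM_zero tendsto_norm_zero)
    qed
    from tendsto_add[OF this L[of "L x"]] show ?thesis
      by (simp add: blinfun.bilinear_simps)
  qed
  show ?thesis
  proof (rule that)
    show "norm L \<le> 1"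
      by (rule norm_blinfun_bound) (use v1 in \<open>auto simp: L_def bounded_linear_Blinfun_apply[OF bl]\<close>)
    show "L = (1/2) *\<^sub>R (Z + (L o\<^sub>L L))"
    proof (rule blinfun_eqI)
      fix x
      have "(\<lambda>n. X (Suc n) x) \<longlonglongrightarrow> L x" using L by (rule LIMSEQ_Suc)
      moreover have "(\<lambda>n. X (Suc n) x) \<longlonglongrightarrow> (1/2) *\<^sub>R (Z x + L (L x))"
        unfolding XS by (simp only: blinfun.bilinear_simps blinfun_apply_blinfun_compose)
          (intro tendsto_intros L2)
      ultimately have "L x = (1/2) *\<^sub>R (Z x + L (L x))" by (rule LIMSEQ_unique)
      then show "L x = ((1/2) *\<^sub>R (Z + (L o\<^sub>L L))) x"
        by (simp add: blinfun.bilinear_simps)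
    qed
    have saX: "self_adjoint (X n)" for n
    proof (induction n)
      case (Suc n)
      then show ?case using sa
        by (simp add: XS self_adjoint_def blinfun.bilinear_simps inner_simps)
    qed (simp add: X0 self_adjoint_def)
    show "self_adjoint L"
      unfolding self_adjoint_def
    proof (intro allI)
      fix x y
      have "(\<lambda>n. X n x \<bullet> y) \<longlonglongrightarrow> L x \<bullet> y" by (intro tendsto_intros L)
      moreover have "(\<lambda>n. X n x \<bullet> y) \<longlonglongrightarrow> x \<bullet> L y"
        unfolding self_adjointD[OF saX] by (intro tendsto_intros L)
      ultimately show "L x \<bullet> y = x \<bullet> L y" by (rule LIMSEQ_unique)
    qed
    fix C assume C: "C o\<^sub>L Z = Z o\<^sub>L C"
    then have CZ: "C (Z x) = Z (C x)" for x
      by (metis blinfun_apply_blinfun_compose)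
    have CX: "C (X n x) = X n (C x)" for n x
      by (induction n arbitrary: x) (simp_all add: X0 XS blinfun.bilinear_simps CZ)
    show "C o\<^sub>L L = L o\<^sub>L C"
    proof (rule blinfun_eqI)
      fix x
      have "(\<lambda>n. C (X n x)) \<longlonglongrightarrow> C (L x)" by (intro tendsto_intros L)
      moreover have "(\<lambda>n. C (X n x)) \<longlonglongrightarrow> L (C x)" unfolding CX by (rule L)
      ultimately show "(C o\<^sub>L L) x = (L o\<^sub>L C) x" by (simp add: LIMSEQ_unique)
    qed
  qed
qed

text \<open>For \<open>c\<close> at least \<open>norm T\<close>, the operator
  \<open>Z = I - T / c\<close> is a contraction, and the fixed point with
  \<open>(I - X)^2 = I - Z = T / c\<close> yields the root \<open>sqrt c (I - X)\<close>, positive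
  because \<open>norm X \<le> 1\<close>. The 1 in \<open>c\<close> covers \<open>T = 0\<close>. The
  commutation clause serves twice: for uniqueness of the root, and later to move the roots of
  \<open>P\<close> and \<open>Q\<close> past \<open>Q\<close> and \<open>P\<close>.\<close>

lemma positive_op_sqrt_exists:
  fixes T :: "'a::{real_inner, complete_space} \<Rightarrow>\<^sub>L 'a"
  assumes T: "positive_op T"
  obtains R where "positive_op R" "R o\<^sub>L R = T"
    "\<And>C. C o\<^sub>L T = T o\<^sub>L C \<Longrightarrow> C o\<^sub>L R = R o\<^sub>L C"
proof -
  define c where "c = norm T + 1"
  have c: "c > 0" "norm T \<le> c" by (auto simp: c_def add_nonneg_pos)
  define Z where "Z = id_blinfun - (1/c) *\<^sub>R T"
  have Zx: "Z x = x - (1/c) *\<^sub>R T x" for x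
    by (simp add: Z_def blinfun.bilinear_simps)
  have saZ: "self_adjoint Z"
    using positive_opD(1)[OF T] by (simp add: self_adjoint_def Zx inner_simps)
  have "norm Z \<le> 1"
  proof (rule norm_blinfun_bound)
    fix x
    \<comment> \<open>In the expansion of the square of \<open>norm (Z x)\<close> the term quadratic
      in \<open>T x\<close> must be outweighed by the mixed term; this is where positivity of
      \<open>T\<close> enters.\<close>
    have "(norm (T x))\<^sup>2 \<le> c * (T x \<bullet> x)"
      using positive_op_norm_sq_le[OF T, of x] mult_right_mono[OF c(2) positive_opD(2)[OF T, of x]]
      by linarith
    moreover have "0 \<le> c * (T x \<bullet> x)" using c positive_opD(2)[OF T, of x] by simp
    ultimately have "(norm (T x))\<^sup>2 \<le> 2 * c * (T x \<bullet> x)" by linarith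
    then have "(1/c)\<^sup>2 * (norm (T x))\<^sup>2 \<le> (1/c)\<^sup>2 * (2 * c * (T x \<bullet> x))"
      by (rule mult_left_mono) simp
    then have "(1/c)\<^sup>2 * (norm (T x))\<^sup>2 \<le> 2 * (1/c) * (T x \<bullet> x)"
      using c by (simp add: power2_eq_square)
    moreover have "(norm (Z x))\<^sup>2 = (norm x)\<^sup>2 - 2 * (1/c) * (T x \<bullet> x) + (1/c)\<^sup>2 * (norm (T x))\<^sup>2"
      unfolding Zx power2_norm_eq_inner
      by (simp add: inner_simps power2_eq_square inner_commute algebra_simps)
    ultimately have "(norm (Z x))\<^sup>2 \<le> (norm x)\<^sup>2" by linarith
    then have "norm (Z x) \<le> norm x" by (rule power2_le_imp_le) simp
    then show "norm (Z x) \<le> 1 * norm x" by simp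
  qed simp
  from contraction_quadratic_fixpoint[OF this saZ]
  obtain X where X: "norm X \<le> 1" "X = (1/2) *\<^sub>R (Z + (X o\<^sub>L X))" "self_adjoint X"
    and comm: "\<And>C. C o\<^sub>L Z = Z o\<^sub>L C \<Longrightarrow> C o\<^sub>L X = X o\<^sub>L C"
    by blast
  have Xx: "X (X x) = 2 *\<^sub>R X x - Z x" for x
  proof -
    have "X x = ((1/2) *\<^sub>R (Z + (X o\<^sub>L X))) x" by (simp only: X(2)[symmetric])
    also have "\<dots> = (1/2) *\<^sub>R (Z x + X (X x))" by (simp add: blinfun.bilinear_simps)
    finally have "2 *\<^sub>R X x = 2 *\<^sub>R ((1/2) *\<^sub>R (Z x + X (X x)))" by (rule arg_cong)
    also have "\<dots> = Z x + X (X x)" by simp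
    finally show ?thesis by simp
  qed
  define R where "R = sqrt c *\<^sub>R (id_blinfun - X)"
  have Rx: "R x = sqrt c *\<^sub>R (x - X x)" for x
    by (simp add: R_def blinfun.bilinear_simps)
  show ?thesis
  proof (rule that)
    have "X x \<bullet> x \<le> x \<bullet> x" for x
    proof -
      have "X x \<bullet> x \<le> norm (X x) * norm x" by (rule norm_cauchy_schwarz)
      also have "\<dots> \<le> (norm X * norm x) * norm x" by (intro mult_right_mono norm_blinfun) simp
      also have "\<dots> \<le> (1 * norm x) * norm x" using X(1) by (intro mult_right_mono) auto
      finally show ?thesis by (simp add: dot_square_norm power2_eq_square)
    qed
    then show "positive_op R"
      using X(3) c by (simp add: positive_op_def self_adjoint_def Rx inner_simps)
    have RR: "R (R x) = c *\<^sub>R (x - 2 *\<^sub>R X x + X (X x))" for x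
    proof -
      have "R (R x) = (sqrt c * sqrt c) *\<^sub>R ((x - X x) - (X x - X (X x)))"
        by (simp only: Rx blinfun.bilinear_simps scaleR_scaleR[symmetric] scaleR_diff_right)
      also have "(x - X x) - (X x - X (X x)) = x - 2 *\<^sub>R X x + X (X x)"
        by (simp add: scaleR_2)
      finally show ?thesis using c by simp
    qed
    show "R o\<^sub>L R = T"
      by (rule blinfun_eqI) (use c in \<open>simp add: RR Xx Zx\<close>)
    fix C assume C: "C o\<^sub>L T = T o\<^sub>L C"
    then have CT: "C (T x) = T (C x)" for x by (metis blinfun_apply_blinfun_compose)
    have "C o\<^sub>L X = X o\<^sub>L C"
      by (rule comm, rule blinfun_eqI) (simp add: Zx blinfun.bilinear_simps CT)
    then have CX: "C (X x) = X (C x)" for x by (metis blinfun_apply_blinfun_compose)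
    show "C o\<^sub>L R = R o\<^sub>L C"
      by (rule blinfun_eqI) (simp add: Rx blinfun.bilinear_simps CX)
  qed
qed

text \<open>For \<open>y = (R - R') x\<close>, commutation gives \<open>(R + R') y = 0\<close>. Both
  forms are nonnegative, so each vanishes at \<open>y\<close>, hence \<open>R y = R' y = 0\<close>,
  and moving \<open>R - R'\<close> across the inner product makes \<open>y\<close> orthogonal to
  itself.\<close>

lemma commuting_sqrt_unique:
  fixes R R' :: "'a::real_inner \<Rightarrow>\<^sub>L 'a"
  assumes R: "positive_op R" and R': "positive_op R'"
    and sq: "R o\<^sub>L R = R' o\<^sub>L R'" and comm: "R o\<^sub>L R' = R' o\<^sub>L R"
  shows "R = R'"
proof (rule blinfun_eqI)
  fix x
  have sqx: "R (R z) = R' (R' z)" and commx: "R (R' z) = R' (R z)" for z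
    using sq comm by (metis blinfun_apply_blinfun_compose)+
  define y where "y = R x - R' x"
  have "R y + R' y = 0"
    by (simp add: y_def blinfun.bilinear_simps sqx commx)
  then have "R y \<bullet> y + R' y \<bullet> y = 0" by (metis inner_add_left inner_zero_left)
  then have "R y \<bullet> y = 0" "R' y \<bullet> y = 0"
    using positive_opD(2)[OF R, of y] positive_opD(2)[OF R', of y] by linarith+
  then have "R y = 0" "R' y = 0" using R R' positive_op_eq_0 by blast+
  then have "R x \<bullet> y - R' x \<bullet> y = 0"
    using R R' by (simp add: positive_op_def self_adjoint_def)
  then have "y \<bullet> y = 0" by (simp add: y_def inner_diff_left)
  then show "R x = R' x" by (simp add: y_def)
qed

text \<open>Any root \<open>R'\<close> commutes with \<open>T\<close>, being a factor of it, and
  therefore with the root \<open>Q\<close> produced by the iteration. Thus every root equals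
  \<open>Q\<close>.\<close>

lemma op_sqrt_eqI:
  fixes T :: "'a::{real_inner, complete_space} \<Rightarrow>\<^sub>L 'a"
  assumes R: "positive_op R" "R o\<^sub>L R = T"
  shows "op_sqrt T = R"
proof -
  have "positive_op T" using R positive_op_square positive_opD(1) by blast
  from positive_op_sqrt_exists[OF this]
  obtain Q where Q: "positive_op Q" "Q o\<^sub>L Q = T"
    and comm: "\<And>C. C o\<^sub>L T = T o\<^sub>L C \<Longrightarrow> C o\<^sub>L Q = Q o\<^sub>L C" by metis
  have *: "R' = Q" if "positive_op R'" "R' o\<^sub>L R' = T" for R'
  proof (rule commuting_sqrt_unique)
    show "R' o\<^sub>L Q = Q o\<^sub>L R'"
      by (rule comm, unfold that(2)[symmetric], rule blinfun_eqI) simp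
  qed (use that Q in auto)
  show ?thesis unfolding op_sqrt_def
    by (rule the_equality) (use R * in auto)
qed

lemma
  fixes T :: "'a::{real_inner, complete_space} \<Rightarrow>\<^sub>L 'a"
  assumes "positive_op T"
  shows positive_op_sqrt: "positive_op (op_sqrt T)"
    and op_sqrt_square: "op_sqrt T o\<^sub>L op_sqrt T = T"
    and op_sqrt_commute: "C o\<^sub>L T = T o\<^sub>L C \<Longrightarrow> C o\<^sub>L op_sqrt T = op_sqrt T o\<^sub>L C"
  using positive_op_sqrt_exists[OF assms] op_sqrt_eqI by metis+

lemma op_adjoint_eqI:
  fixes T R :: "'a::real_inner \<Rightarrow>\<^sub>L 'a"
  assumes "\<And>x y. T x \<bullet> y = x \<bullet> R y"
  shows "op_adjoint T = R"
proof -
  have "adjoint (blinfun_apply T) = blinfun_apply R"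
    using assms by (intro adjoint_unique) simp
  then show ?thesis by (simp add: op_adjoint_def blinfun_apply_inverse)
qed

lemma op_abs_self_adjoint: "self_adjoint T \<Longrightarrow> op_abs T = op_sqrt (T o\<^sub>L T)"
  by (simp add: op_abs_def op_adjoint_eqI self_adjointD)

lemma op_abs_eqI:
  fixes T :: "'a::{real_inner, complete_space} \<Rightarrow>\<^sub>L 'a"
  assumes "self_adjoint T" "positive_op R" "R o\<^sub>L R = T o\<^sub>L T"
  shows "op_abs T = R"
  by (simp add: assms op_abs_self_adjoint op_sqrt_eqI)

lemma
  fixes T :: "'a::{real_inner, complete_space} \<Rightarrow>\<^sub>L 'a"
  assumes "self_adjoint T"
  shows positive_op_abs: "positive_op (op_abs T)"
    and op_abs_square: "op_abs T o\<^sub>L op_abs T = T o\<^sub>L T"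
  using assms by (simp_all add: op_abs_self_adjoint positive_op_square positive_op_sqrt op_sqrt_square)

section \<open>Positive invertible operators\<close>

text \<open>As \<open>m\<close> is real, the complexified shift acts as \<open>T - m\<close> on each
  component separately; the real part of its inverse on vectors \<open>(x, 0)\<close> therefore
  inverts \<open>T - m\<close>.\<close>

lemma op_invertible_shift:
  fixes T :: "'a::real_normed_vector \<Rightarrow>\<^sub>L 'a"
  assumes "complex_of_real m \<notin> spectrum T"
  shows "op_invertible (T - m *\<^sub>R id_blinfun)"
proof -
  obtain R where "is_op_inverse (complexify T - cmult (complex_of_real m)) R"
    using assms by (auto simp: spectrum_def op_invertible_def)
  then have R1: "(complexify T - cmult (complex_of_real m)) (R z) = z"
    and R2: "R ((complexify T - cmult (complex_of_real m)) z) = z" for z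
    by (simp_all only: is_op_inverse_def blinfun_eq_iff blinfun_apply_blinfun_compose
        blinfun_apply_id_blinfun)
  define r where "r = Blinfun (\<lambda>x. fst (R (x, 0)))"
  have r: "r x = fst (R (x, 0))" for x
    unfolding r_def
    by (subst bounded_linear_Blinfun_apply) (intro bounded_linear_intros, simp)
  have "(T - m *\<^sub>R id_blinfun) (r x) = x" for x
  proof -
    obtain u v where uv: "R (x, 0) = (u, v)" by fastforce
    show ?thesis using R1[of "(x, 0)"] by (simp add: r uv blinfun.bilinear_simps)
  qed
  moreover have "r ((T - m *\<^sub>R id_blinfun) x) = x" for x
    using R2[of "(x, 0)"] by (simp add: r blinfun.diff_left blinfun.scaleR_left)
  ultimately show ?thesis
    by (auto simp: op_invertible_def is_op_inverse_def blinfun_eq_iff)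
qed

text \<open>If the infimum \<open>m\<close> of the quadratic form on the unit sphere were negative, then \<open>T - m\<close>
  would be positive and bounded below, hence its form would be bounded away from \<open>0\<close>.\<close>

lemma positive_invertible_positive_op:
  fixes T :: "'a::real_inner \<Rightarrow>\<^sub>L 'a"
  assumes T: "positive_invertible T"
  shows "positive_op T"
proof -
  have sa: "self_adjoint T" and sp: "spectrum T \<subseteq> complex_of_real ` {0<..}"
    using T by (auto simp: positive_invertible_def)
  define m where "m = Inf {T x \<bullet> x |x. norm x = 1}"
  have bdd: "bdd_below {T x \<bullet> x |x. norm x = 1}"
  proof (rule bdd_belowI)
    fix t assume "t \<in> {T x \<bullet> x |x. norm x = 1}"
    then obtain x where x: "t = T x \<bullet> x" "norm x = 1" by blast
    have "\<bar>t\<bar> \<le> norm (T x) * norm x" unfolding x(1) by (rule Cauchy_Schwarz_ineq2)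
    with norm_blinfun[of T x] x(2) show "- norm T \<le> t" by simp
  qed
  have m_le: "m \<le> T x \<bullet> x" if "norm x = 1" for x
    unfolding m_def using bdd that by (intro cInf_lower) auto
  have homog: "m * (norm x)\<^sup>2 \<le> T x \<bullet> x" for x
  proof (cases "x = 0")
    case False
    then have "m \<le> T (x /\<^sub>R norm x) \<bullet> (x /\<^sub>R norm x)" by (intro m_le) simp
    with False show ?thesis
      by (simp add: blinfun.bilinear_simps power2_eq_square field_simps)
  qed simp
  show ?thesis
  proof (rule ccontr)
    assume "\<not> positive_op T"
    then obtain x0 where x0: "T x0 \<bullet> x0 < 0"
      using sa by (auto simp: positive_op_def not_le)
    then have ne: "{T x \<bullet> x |x. norm x = 1} \<noteq> {}"
      by (auto intro!: exI[of _ "x0 /\<^sub>R norm x0"] left_inverse)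
    have "m < 0"
    proof -
      have "m * (norm x0)\<^sup>2 < 0" using homog[of x0] x0 by linarith
      then show ?thesis by (simp add: mult_less_0_iff)
    qed
    then have "complex_of_real m \<notin> spectrum T" using sp by auto
    from op_invertible_shift[OF this] obtain R
      where R: "is_op_inverse (T - m *\<^sub>R id_blinfun) R"
      by (auto simp: op_invertible_def)
    define U where "U = T - m *\<^sub>R id_blinfun"
    have Ux: "U x = T x - m *\<^sub>R x" for x by (simp add: U_def blinfun.bilinear_simps)
    have RU: "R (U x) = x" for x
      using R by (auto simp: is_op_inverse_def U_def[symmetric] blinfun_eq_iff)
    have pos: "positive_op U"
      using sa homog
      by (auto simp: positive_op_def self_adjoint_def Ux inner_simps power2_norm_eq_inner)
    \<comment> \<open>On unit vectors \<open>1 = (norm (R (U x)))^2\<close> is at most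
      \<open>(norm R)^2 * norm U\<close> times the form of \<open>U\<close>. Adding 1 makes the
      constant safely positive.\<close>
    define C where "C = (norm R)\<^sup>2 * norm U + 1"
    have C: "C > 0" by (simp add: C_def add_nonneg_pos)
    have low: "1 / C \<le> U x \<bullet> x" if "norm x = 1" for x
    proof -
      have "1 \<le> norm R * norm (U x)"
        using norm_blinfun[of R "U x"] that by (simp add: RU)
      then have "1\<^sup>2 \<le> (norm R * norm (U x))\<^sup>2" by (rule power_mono) simp
      also have "\<dots> \<le> (norm R)\<^sup>2 * (norm U * (U x \<bullet> x))"
        unfolding power_mult_distrib by (intro mult_left_mono positive_op_norm_sq_le pos) simp
      also have "\<dots> \<le> C * (U x \<bullet> x)"
        using positive_opD(2)[OF pos, of x] by (simp add: C_def algebra_simps)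
      finally show ?thesis using C by (simp add: field_simps)
    qed
    have "m + 1 / C \<le> Inf {T x \<bullet> x |x. norm x = 1}"
    proof (rule cInf_greatest[OF ne])
      fix t assume "t \<in> {T x \<bullet> x |x. norm x = 1}"
      then obtain x where "t = T x \<bullet> x" "norm x = 1" by blast
      then show "m + 1 / C \<le> t"
        using low[of x] by (simp add: Ux inner_simps power2_norm_eq_inner[symmetric])
    qed
    then have "m + 1 / C \<le> m" by (simp only: m_def[symmetric])
    then show False using C by simp
  qed
qed

lemma positive_invertible_op_invertible:
  assumes "positive_invertible T"
  shows "op_invertible T"
proof -
  have "complex_of_real 0 \<notin> spectrum T"
    using assms by (auto simp: positive_invertible_def)
  from op_invertible_shift[OF this] show ?thesis by simp
qed

section \<open>Orthonormal bases\<close>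

lemma orthonormal_inner:
  assumes "pairwise orthogonal E" "\<forall>e\<in>E. norm e = 1" "e \<in> E" "f \<in> E"
  shows "e \<bullet> f = (if e = f then 1 else 0)"
  using assms by (auto simp: pairwise_def orthogonal_def dot_square_norm)

text \<open>Completing the square in the coefficients. The choice \<open>c e = x \<bullet> e\<close>
  gives Bessel's inequality, and dropping the last sum shows that no other choice approximates
  better.\<close>

lemma norm_sq_diff_orthonormal:
  fixes x :: "'a::real_inner"
  assumes E: "pairwise orthogonal E" "\<forall>e\<in>E. norm e = 1" and F: "finite F" "F \<subseteq> E"
  shows "(norm (x - (\<Sum>e\<in>F. c e *\<^sub>R e)))\<^sup>2
    = (norm x)\<^sup>2 - (\<Sum>e\<in>F. (x \<bullet> e)\<^sup>2) + (\<Sum>e\<in>F. (x \<bullet> e - c e)\<^sup>2)"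
proof -
  have "(\<Sum>e\<in>F. c e *\<^sub>R e) \<bullet> (\<Sum>e\<in>F. c e *\<^sub>R e) = (\<Sum>e\<in>F. \<Sum>f\<in>F. c e * (c f * (f \<bullet> e)))"
    by (simp add: inner_sum_left inner_sum_right sum_distrib_left)
  also have "\<dots> = (\<Sum>e\<in>F. \<Sum>f\<in>F. if e = f then (c e)\<^sup>2 else 0)"
    using F by (intro sum.cong refl) (auto simp: orthonormal_inner[OF E] power2_eq_square subset_iff)
  also have "\<dots> = (\<Sum>e\<in>F. (c e)\<^sup>2)"
    using F by simp
  finally have "(norm (x - (\<Sum>e\<in>F. c e *\<^sub>R e)))\<^sup>2
      = (norm x)\<^sup>2 - 2 * (\<Sum>e\<in>F. c e * (x \<bullet> e)) + (\<Sum>e\<in>F. (c e)\<^sup>2)"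
    by (simp add: power2_norm_eq_inner inner_diff inner_commute inner_sum_left inner_sum_right)
  also have "\<dots> = (norm x)\<^sup>2 - (\<Sum>e\<in>F. (x \<bullet> e)\<^sup>2) + (\<Sum>e\<in>F. (x \<bullet> e - c e)\<^sup>2)"
    by (simp add: power2_diff sum.distrib sum_subtractf sum_distrib_left mult_ac)
  finally show ?thesis .
qed

text \<open>Bessel bounds the sum from above. For the lower bound, density of the span supplies a
  finite combination close to \<open>x\<close>, and its Fourier coefficients do at least as
  well.\<close>

lemma parseval:
  fixes x :: "'a::real_inner"
  assumes E: "orthonormal_basis E"
  shows "((\<lambda>e. (x \<bullet> e)\<^sup>2) has_sum (norm x)\<^sup>2) E"
proof -
  have on: "pairwise orthogonal E" "\<forall>e\<in>E. norm e = 1"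
    using E by (auto simp: orthonormal_basis_def)
  have bessel: "(\<Sum>e\<in>F. (x \<bullet> e)\<^sup>2) \<le> (norm x)\<^sup>2" if "finite F" "F \<subseteq> E" for F
  proof -
    have "0 \<le> (norm (x - (\<Sum>e\<in>F. (x \<bullet> e) *\<^sub>R e)))\<^sup>2" by simp
    also have "\<dots> = (norm x)\<^sup>2 - (\<Sum>e\<in>F. (x \<bullet> e)\<^sup>2)"
      by (subst norm_sq_diff_orthonormal[OF on that]) simp
    finally show ?thesis by simp
  qed
  have "(\<lambda>e. (x \<bullet> e)\<^sup>2) summable_on E"
    by (rule nonneg_bdd_above_summable_on) (use bessel in \<open>auto intro!: bdd_aboveI\<close>)
  then obtain s where s: "((\<lambda>e. (x \<bullet> e)\<^sup>2) has_sum s) E" by (auto simp: summable_on_def)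
  have "s \<le> (norm x)\<^sup>2"
    by (rule has_sum_le_finite_sums[OF s]) (use bessel in auto)
  moreover have "(norm x)\<^sup>2 \<le> s"
  proof (rule field_le_epsilon)
    fix d :: real assume d: "0 < d"
    have "x \<in> closure (span E)" using E by (simp add: orthonormal_basis_def)
    moreover have "sqrt d > 0" using d by simp
    ultimately obtain y where y: "y \<in> span E" "dist y x < sqrt d"
      unfolding closure_approachable by blast
    from y(1) obtain F c where F: "finite F" "F \<subseteq> E" and yF: "y = (\<Sum>e\<in>F. c e *\<^sub>R e)"
      unfolding span_explicit by blast
    have "(norm x)\<^sup>2 - (\<Sum>e\<in>F. (x \<bullet> e)\<^sup>2) \<le> (norm (x - y))\<^sup>2"
      unfolding yF norm_sq_diff_orthonormal[OF on F] by (simp add: sum_nonneg)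
    also have "\<dots> \<le> (sqrt d)\<^sup>2"
      using y(2) by (intro power_mono) (auto simp: dist_norm norm_minus_commute)
    finally have "(norm x)\<^sup>2 \<le> (\<Sum>e\<in>F. (x \<bullet> e)\<^sup>2) + d" using d by simp
    also have "(\<Sum>e\<in>F. (x \<bullet> e)\<^sup>2) \<le> s"
      by (rule finite_sum_le_has_sum[OF s F]) simp
    finally show "(norm x)\<^sup>2 \<le> s + d" by simp
  qed
  ultimately show ?thesis using s by simp
qed

text \<open>One step of Gram-Schmidt; the residual of \<open>d\<close> is normalised and added only
  when it is nonzero.\<close>

lemma orthonormal_extend_finite:
  fixes d :: "'a::real_inner"
  assumes F: "finite F" "pairwise orthogonal F" "\<forall>e\<in>F. norm e = 1"
  obtains G where "finite G" "pairwise orthogonal G" "\<forall>e\<in>G. norm e = 1" "F \<subseteq> G" "d \<in> span G"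
proof -
  define p where "p = (\<Sum>e\<in>F. (d \<bullet> e) *\<^sub>R e)"
  define y where "y = d - p"
  have p: "p \<in> span F"
    unfolding p_def by (intro span_sum span_mul span_base)
  have orth: "y \<bullet> f = 0" if "f \<in> F" for f
  proof -
    have "p \<bullet> f = (\<Sum>e\<in>F. if e = f then d \<bullet> f else 0)"
      unfolding p_def inner_sum_left
      using that by (intro sum.cong refl) (auto simp: orthonormal_inner[OF F(2,3)])
    also have "\<dots> = d \<bullet> f" using that F(1) by simp
    finally show ?thesis by (simp add: y_def inner_diff_left)
  qed
  define G where "G = (if y = 0 then F else insert (y /\<^sub>R norm y) F)"
  show ?thesis
  proof (rule that)
    show "finite G" using F by (simp add: G_def)
    show "pairwise orthogonal G"
      using F(2) orth by (auto simp: G_def pairwise_insert orthogonal_def inner_commute)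
    show "\<forall>e\<in>G. norm e = 1" using F(3) by (auto simp: G_def)
    show FG: "F \<subseteq> G" by (auto simp: G_def)
    have "y \<in> span G"
    proof (cases "y = 0")
      case False
      then have "norm y *\<^sub>R (y /\<^sub>R norm y) \<in> span G"
        by (intro span_mul span_base) (simp add: G_def)
      with False show ?thesis by simp
    qed (simp add: span_zero)
    then have "y + p \<in> span G" using p span_mono[OF FG] by (intro span_add) auto
    then show "d \<in> span G" by (simp add: y_def)
  qed
qed

text \<open>Gram-Schmidt along an enumeration of a countable dense set: dependent choice gives an
  increasing chain of finite orthonormal sets, and the span of their union contains the dense
  set.\<close>

lemma orthonormal_basis_exists:
  obtains E :: "'a::{real_inner, second_countable_topology} set" where "orthonormal_basis E"
proof -
  obtain D :: "'a set" where D: "countable D" "\<And>X. open X \<Longrightarrow> X \<noteq> {} \<Longrightarrow> \<exists>d\<in>D. d \<in> X"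
    by (rule countable_dense_setE) blast
  define P where "P F \<longleftrightarrow> finite F \<and> pairwise orthogonal F \<and> (\<forall>e\<in>F. norm e = 1)" for F :: "'a set"
  have "\<exists>G. P G \<and> F \<subseteq> G \<and> d \<in> span G" if "P F" for F d
    using that orthonormal_extend_finite[of F d] unfolding P_def by metis
  then have "\<exists>X. \<forall>n::nat. P (X n) \<and> (X n \<subseteq> X (Suc n) \<and> from_nat_into D n \<in> span (X (Suc n)))"
    by (intro dependent_nat_choice) (auto simp: P_def intro!: exI[of _ "{}"])
  then obtain X where X: "\<And>n. P (X n)" "\<And>n. X n \<subseteq> X (Suc n)"
    and Xd: "\<And>n. from_nat_into D n \<in> span (X (Suc n))" by blast
  have mono: "X m \<subseteq> X n" if "m \<le> n" for m n
    using X(2) that by (rule lift_Suc_mono_le)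
  have "orthonormal_basis (\<Union>n. X n)"
    unfolding orthonormal_basis_def
  proof (intro conjI)
    show "pairwise orthogonal (\<Union>n. X n)"
      unfolding pairwise_def
    proof (intro ballI impI)
      fix e f assume "e \<in> (\<Union>n. X n)" "f \<in> (\<Union>n. X n)" and ne: "e \<noteq> f"
      then obtain m n where "e \<in> X m" "f \<in> X n" by blast
      then have "e \<in> X (max m n)" "f \<in> X (max m n)" using mono by (meson max.cobounded1 max.cobounded2 subsetD)+
      with X(1)[of "max m n"] ne show "orthogonal e f" by (auto simp: P_def pairwise_def)
    qed
    show "\<forall>e\<in>\<Union>n. X n. norm e = 1" using X(1) by (auto simp: P_def)
    have "D \<subseteq> span (\<Union>n. X n)"
    proof
      fix d assume "d \<in> D"
      then obtain n where "d = from_nat_into D n" using from_nat_into_surj[OF D(1)] by metis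
      then show "d \<in> span (\<Union>n. X n)" using Xd[of n] span_mono[of "X (Suc n)" "\<Union>n. X n"] by auto
    qed
    moreover have "closure D = UNIV"
    proof -
      have "x \<in> closure D" for x
        unfolding closure_approachable
      proof (intro allI impI)
        fix e :: real assume "0 < e"
        then show "\<exists>d\<in>D. dist d x < e"
          using D(2)[of "ball x e"] by (auto simp: dist_commute)
      qed
      then show ?thesis by blast
    qed
    ultimately show "closure (span (\<Union>n. X n)) = UNIV"
      using closure_mono by blast
  qed
  then show ?thesis by (rule that)
qed

section \<open>Hilbert--Schmidt and trace class operators\<close>

lemma has_sum_finite_sum:
  fixes f :: "'i \<Rightarrow> 'a \<Rightarrow> 'b::topological_comm_monoid_add"
  assumes "finite I" "\<And>i. i \<in> I \<Longrightarrow> (f i has_sum s i) A"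
  shows "((\<lambda>x. \<Sum>i\<in>I. f i x) has_sum (\<Sum>i\<in>I. s i)) A"
  using assms by (induction I rule: finite_induct) (auto intro: has_sum_add)

text \<open>Both sums are the double sum of the squares of \<open>T f \<bullet> e\<close>. Keeping
  \<open>f\<close> in a finite set \<open>G\<close> avoids interchanging infinite sums: Parseval
  over \<open>E\<close> evaluates one side, Bessel over \<open>G\<close> bounds the other.\<close>

lemma hilbert_schmidt_basis_indep:
  assumes sa: "self_adjoint T" and E: "orthonormal_basis E" and F: "orthonormal_basis F"
    and sum: "(\<lambda>e. (norm (T e))\<^sup>2) summable_on E"
  shows "(\<lambda>f. (norm (T f))\<^sup>2) summable_on F"
proof (rule nonneg_bdd_above_summable_on)
  have "(\<Sum>f\<in>G. (norm (T f))\<^sup>2) \<le> (\<Sum>\<^sub>\<infinity>e\<in>E. (norm (T e))\<^sup>2)" if G: "finite G" "G \<subseteq> F" for G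
  proof (rule has_sum_mono)
    show "((\<lambda>e. \<Sum>f\<in>G. (T f \<bullet> e)\<^sup>2) has_sum (\<Sum>f\<in>G. (norm (T f))\<^sup>2)) E"
      by (intro has_sum_finite_sum parseval E G)
    show "((\<lambda>e. (norm (T e))\<^sup>2) has_sum (\<Sum>\<^sub>\<infinity>e\<in>E. (norm (T e))\<^sup>2)) E"
      using sum by (rule has_sum_infsum)
    fix e assume "e \<in> E"
    have "(\<Sum>f\<in>G. (T e \<bullet> f)\<^sup>2) \<le> (norm (T e))\<^sup>2"
      by (rule finite_sum_le_has_sum[OF parseval[OF F] G]) simp
    then show "(\<Sum>f\<in>G. (T f \<bullet> e)\<^sup>2) \<le> (norm (T e))\<^sup>2"
      using sa by (simp add: self_adjoint_def inner_commute)
  qed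
  then show "bdd_above (sum (\<lambda>f. (norm (T f))\<^sup>2) ` {G. G \<subseteq> F \<and> finite G})"
    by (intro bdd_aboveI) auto
qed simp

lemma hilbert_schmidt_iff_basis:
  assumes "self_adjoint T" "orthonormal_basis E"
  shows "hilbert_schmidt T \<longleftrightarrow> (\<lambda>e. (norm (T e))\<^sup>2) summable_on E"
  using assms hilbert_schmidt_basis_indep unfolding hilbert_schmidt_def by blast

lemma inner_eq_norm_op_sqrt:
  fixes R :: "'a::{real_inner, complete_space} \<Rightarrow>\<^sub>L 'a"
  assumes "positive_op R"
  shows "R x \<bullet> x = (norm (op_sqrt R x))\<^sup>2"
  using op_sqrt_square[OF assms] positive_opD(1)[OF positive_op_sqrt[OF assms]]
  by (metis blinfun_apply_blinfun_compose power2_norm_eq_inner self_adjointD)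

text \<open>The trace sum of \<open>op_abs T\<close> is the Hilbert-Schmidt sum of its square root,
  so independence of the basis is inherited.\<close>

lemma trace_class_iff_basis:
  fixes T :: "'a::{real_inner, complete_space} \<Rightarrow>\<^sub>L 'a"
  assumes sa: "self_adjoint T" and E: "orthonormal_basis E"
  shows "trace_class T \<longleftrightarrow> (\<lambda>e. op_abs T e \<bullet> e) summable_on E"
proof -
  have "self_adjoint (op_sqrt (op_abs T))"
    by (intro positive_opD(1) positive_op_sqrt positive_op_abs sa)
  then show ?thesis
    unfolding trace_class_def inner_eq_norm_op_sqrt[OF positive_op_abs[OF sa]]
    using E hilbert_schmidt_basis_indep by blast
qed

text \<open>\<open>V\<close> is isometric and, as its own inverse, onto; continuity carries the
  density of the span over.\<close>

lemma orthonormal_basis_image: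
  fixes V :: "'a::real_inner \<Rightarrow>\<^sub>L 'a"
  assumes sa: "self_adjoint V" and inv: "V o\<^sub>L V = id_blinfun" and E: "orthonormal_basis E"
  shows "orthonormal_basis (V ` E)"
proof -
  have VV: "V (V x) = x" for x using inv by (metis blinfun_apply_blinfun_compose blinfun_apply_id_blinfun)
  have iso: "V x \<bullet> V y = x \<bullet> y" for x y by (simp add: self_adjointD[OF sa] VV)
  have nrm: "norm (V x) = norm x" for x by (simp add: norm_eq_sqrt_inner iso)
  have "closure (span (V ` E)) = UNIV"
  proof -
    have "x \<in> closure (span (V ` E))" for x
    proof -
      have "x = V (V x)" by (simp add: VV)
      also have "\<dots> \<in> V ` closure (span E)" using E by (simp add: orthonormal_basis_def)
      also have "\<dots> \<subseteq> closure (V ` span E)"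
        by (intro closure_bounded_linear_image_subset blinfun.bounded_linear_right)
      also have "V ` span E = span (V ` E)"
        by (simp add: linear_span_image blinfun.bounded_linear_right bounded_linear.linear)
      finally show ?thesis .
    qed
    then show ?thesis by blast
  qed
  moreover have "pairwise orthogonal (V ` E)"
    using E by (auto simp: orthonormal_basis_def pairwise_def orthogonal_def iso)
  ultimately show ?thesis using E by (auto simp: orthonormal_basis_def nrm)
qed

text \<open>A basis adapted to the splitting, on which sums for block diagonal operators separate.
  Density follows from \<open>(x, y) = (x, 0) + (0, y)\<close>.\<close>

lemma orthonormal_basis_Plus:
  fixes E :: "'a::real_inner set" and F :: "'b::real_inner set"
  assumes E: "orthonormal_basis E" and F: "orthonormal_basis F"
  shows "orthonormal_basis ((\<lambda>e. (e, 0)) ` E \<union> (\<lambda>f. (0, f)) ` F)" (is "orthonormal_basis ?G")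
proof -
  have inl: "bounded_linear (\<lambda>e::'a. (e, 0::'b))" and inr: "bounded_linear (\<lambda>f::'b. (0::'a, f))"
    by (intro bounded_linear_intros)+
  let ?l = "\<lambda>e::'a. (e, 0::'b)" and ?r = "\<lambda>f::'b. (0::'a, f)"
  have cl: "(x, 0) \<in> closure (span ?G)" for x
  proof -
    have "(x, 0) \<in> ?l ` closure (span E)" using E by (simp add: orthonormal_basis_def)
    also have "\<dots> \<subseteq> closure (?l ` span E)"
      by (rule closure_bounded_linear_image_subset[OF inl])
    also have "?l ` span E = span (?l ` E)"
      by (simp add: linear_span_image[OF bounded_linear.linear[OF inl]])
    also have "closure \<dots> \<subseteq> closure (span ?G)" by (intro closure_mono span_mono) auto
    finally show ?thesis .
  qed
  have cr: "(0, y) \<in> closure (span ?G)" for y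
  proof -
    have "(0, y) \<in> ?r ` closure (span F)" using F by (simp add: orthonormal_basis_def)
    also have "\<dots> \<subseteq> closure (?r ` span F)"
      by (rule closure_bounded_linear_image_subset[OF inr])
    also have "?r ` span F = span (?r ` F)"
      by (simp add: linear_span_image[OF bounded_linear.linear[OF inr]])
    also have "closure \<dots> \<subseteq> closure (span ?G)" by (intro closure_mono span_mono) auto
    finally show ?thesis .
  qed
  have "(x, y) \<in> closure (span ?G)" for x y
  proof -
    obtain u v where "\<And>n. u n \<in> span ?G" "u \<longlonglongrightarrow> (x, 0)" "\<And>n. v n \<in> span ?G" "v \<longlonglongrightarrow> (0, y)"
      using cl[of x] cr[of y] unfolding closure_sequential by blast
    moreover from this have "(\<lambda>n. u n + v n) \<longlonglongrightarrow> (x, 0) + (0, y)" by (intro tendsto_add)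
    ultimately show ?thesis
      unfolding closure_sequential by (intro exI[of _ "\<lambda>n. u n + v n"]) (simp add: span_add)
  qed
  then have "z \<in> closure (span ?G)" for z by (cases z) (simp only:)
  then have "closure (span ?G) = UNIV" by blast
  moreover have "pairwise orthogonal ?G"
  proof -
    have oE: "x \<bullet> y = 0" if "x \<in> E" "y \<in> E" "x \<noteq> y" for x y
      using E that by (simp add: orthonormal_basis_def pairwise_def orthogonal_def)
    have oF: "x \<bullet> y = 0" if "x \<in> F" "y \<in> F" "x \<noteq> y" for x y
      using F that by (simp add: orthonormal_basis_def pairwise_def orthogonal_def)
    show ?thesis by (auto simp: pairwise_def orthogonal_def) (metis oE, metis oF)
  qed
  ultimately show ?thesis
    using E F by (auto simp: orthonormal_basis_def norm_Pair)
qed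

text \<open>The two copies could meet only in the origin, which the assumptions exclude.\<close>

lemma summable_on_Plus_iff:
  fixes g :: "'a::zero \<times> 'b::zero \<Rightarrow> real"
  assumes "0 \<notin> E" "0 \<notin> F"
  shows "g summable_on ((\<lambda>e. (e, 0)) ` E \<union> (\<lambda>f. (0, f)) ` F)
    \<longleftrightarrow> (\<lambda>e. g (e, 0)) summable_on E \<and> (\<lambda>f. g (0, f)) summable_on F"
proof -
  let ?E = "(\<lambda>e. (e, 0::'b)) ` E" and ?F = "(\<lambda>f. (0::'a, f)) ` F"
  have "inj_on (\<lambda>e. (e, 0::'b)) E" "inj_on (\<lambda>f. (0::'a, f)) F" by (auto simp: inj_on_def)
  then have 1: "g summable_on ?E \<longleftrightarrow> (\<lambda>e. g (e, 0)) summable_on E"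
    and 2: "g summable_on ?F \<longleftrightarrow> (\<lambda>f. g (0, f)) summable_on F"
    by (simp_all add: summable_on_reindex o_def)
  have disj: "?E \<inter> ?F = {}" using assms by auto
  have "g summable_on (?E \<union> ?F) \<longleftrightarrow> g summable_on ?E \<and> g summable_on ?F"
  proof
    assume "g summable_on (?E \<union> ?F)"
    then show "g summable_on ?E \<and> g summable_on ?F"
      by (intro conjI) (rule summable_on_subset_banach, assumption, simp)+
  next
    assume "g summable_on ?E \<and> g summable_on ?F"
    then show "g summable_on (?E \<union> ?F)"
      by (intro summable_on_Un_disjoint disj) simp_all
  qed
  then show ?thesis by (simp only: 1 2)
qed

section \<open>Block operators and the change of coordinates\<close>

abbreviation diag_op :: "('a::real_normed_vector \<Rightarrow>\<^sub>L 'a) \<Rightarrow> ('a \<Rightarrow>\<^sub>L 'a) \<Rightarrow> ('a \<times> 'a) \<Rightarrow>\<^sub>L ('a \<times> 'a)"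
  where "diag_op P Q \<equiv> block_op P 0 0 Q"

lemma diag_op_compose: "diag_op P Q o\<^sub>L diag_op P' Q' = diag_op (P o\<^sub>L P') (Q o\<^sub>L Q')"
  by (rule blinfun_eqI) (auto simp: split_paired_all)

lemma diag_op_diff: "diag_op P Q - diag_op P' Q' = diag_op (P - P') (Q - Q')"
  by (rule blinfun_eqI) (auto simp: split_paired_all blinfun.diff_left)

lemma diag_op_id: "diag_op id_blinfun id_blinfun = id_blinfun"
  by (rule blinfun_eqI) (auto simp: split_paired_all)

lemma self_adjoint_diag_op:
  "self_adjoint P \<Longrightarrow> self_adjoint Q \<Longrightarrow> self_adjoint (diag_op P Q)"
  by (simp add: self_adjoint_def split_paired_all)

lemma positive_op_diag_op: "positive_op P \<Longrightarrow> positive_op Q \<Longrightarrow> positive_op (diag_op P Q)"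
  by (simp add: positive_op_def self_adjoint_diag_op split_paired_all)

lemma op_sqrt_diag_op:
  fixes P Q :: "'a::{real_inner, complete_space} \<Rightarrow>\<^sub>L 'a"
  assumes "positive_op P" "positive_op Q"
  shows "op_sqrt (diag_op P Q) = diag_op (op_sqrt P) (op_sqrt Q)"
  using assms
  by (intro op_sqrt_eqI positive_op_diag_op) (simp_all add: positive_op_sqrt diag_op_compose op_sqrt_square)

lemma op_abs_diag_op:
  fixes P Q :: "'a::{real_inner, complete_space} \<Rightarrow>\<^sub>L 'a"
  assumes "self_adjoint P" "self_adjoint Q"
  shows "op_abs (diag_op P Q) = diag_op (op_abs P) (op_abs Q)"
  using assms
  by (intro op_abs_eqI positive_op_diag_op)
    (simp_all add: positive_op_abs self_adjoint_diag_op diag_op_compose op_abs_square)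

lemma zero_notin_orthonormal_basis: "orthonormal_basis E \<Longrightarrow> 0 \<notin> E"
  by (auto simp: orthonormal_basis_def)

text \<open>Independence of the basis lets all three conditions be tested on one basis
  \<open>E\<close> and its doubled version.\<close>

lemma hilbert_schmidt_diag_op_iff:
  fixes P Q :: "'a::{real_inner, second_countable_topology} \<Rightarrow>\<^sub>L 'a"
  assumes "self_adjoint P" "self_adjoint Q"
  shows "hilbert_schmidt (diag_op P Q) \<longleftrightarrow> hilbert_schmidt P \<and> hilbert_schmidt Q"
proof -
  obtain E :: "'a set" where E: "orthonormal_basis E" by (rule orthonormal_basis_exists)
  show ?thesis
    using assms
    by (simp add: hilbert_schmidt_iff_basis[OF self_adjoint_diag_op orthonormal_basis_Plus[OF E E]]
        summable_on_Plus_iff zero_notin_orthonormal_basis[OF E] norm_Pair hilbert_schmidt_iff_basis[OF _ E])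
qed

lemma trace_class_diag_op_iff:
  fixes P Q :: "'a::{real_inner, complete_space, second_countable_topology} \<Rightarrow>\<^sub>L 'a"
  assumes "self_adjoint P" "self_adjoint Q"
  shows "trace_class (diag_op P Q) \<longleftrightarrow> trace_class P \<and> trace_class Q"
proof -
  obtain E :: "'a set" where E: "orthonormal_basis E" by (rule orthonormal_basis_exists)
  show ?thesis
    using assms
    by (simp add: trace_class_iff_basis[OF self_adjoint_diag_op orthonormal_basis_Plus[OF E E]]
        summable_on_Plus_iff zero_notin_orthonormal_basis[OF E] op_abs_diag_op trace_class_iff_basis[OF _ E])
qed

section \<open>Conjugation by a self-adjoint involution\<close>

locale symmetry_op =
  fixes V :: "'a::real_inner \<Rightarrow>\<^sub>L 'a"
  assumes sa: "self_adjoint V" and involution: "V o\<^sub>L V = id_blinfun"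
begin

lemma VV [simp]: "V (V x) = x"
  using involution by (metis blinfun_apply_blinfun_compose blinfun_apply_id_blinfun)

lemma inner_V: "V x \<bullet> y = x \<bullet> V y"
  by (rule self_adjointD[OF sa])

lemma norm_V [simp]: "norm (V x) = norm x"
  by (simp add: norm_eq_sqrt_inner inner_V)

definition conj_op :: "('a \<Rightarrow>\<^sub>L 'a) \<Rightarrow> ('a \<Rightarrow>\<^sub>L 'a)"
  where "conj_op T = V o\<^sub>L T o\<^sub>L V"

lemma conj_op_apply [simp]: "conj_op T x = V (T (V x))"
  by (simp add: conj_op_def)

lemma conj_op_id: "conj_op id_blinfun = id_blinfun"
  by (rule blinfun_eqI) simp

lemma conj_op_diff: "conj_op (S - T) = conj_op S - conj_op T"
  by (rule blinfun_eqI) (simp add: blinfun.bilinear_simps)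

lemma conj_op_compose: "conj_op (S o\<^sub>L T) = conj_op S o\<^sub>L conj_op T"
  by (rule blinfun_eqI) simp

lemma self_adjoint_conj_op: "self_adjoint T \<Longrightarrow> self_adjoint (conj_op T)"
  by (simp add: self_adjoint_def[of T] self_adjoint_def[of "conj_op T"] inner_V)

lemma positive_op_conj_op: "positive_op T \<Longrightarrow> positive_op (conj_op T)"
  by (simp add: positive_op_def self_adjoint_conj_op) (simp add: inner_V)

lemma op_invertible_conj_op: "op_invertible T \<Longrightarrow> op_invertible (conj_op T)"
  unfolding op_invertible_def is_op_inverse_def by (metis conj_op_compose conj_op_id)

text \<open>The conjugate sends \<open>V e\<close> to \<open>V (T e)\<close>, so on the image basis
  the sum is literally the old one.\<close>

lemma hilbert_schmidt_conj_opI: "hilbert_schmidt T \<Longrightarrow> hilbert_schmidt (conj_op T)"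
proof -
  assume "hilbert_schmidt T"
  then obtain E where E: "orthonormal_basis E" "(\<lambda>e. (norm (T e))\<^sup>2) summable_on E"
    by (auto simp: hilbert_schmidt_def)
  have "inj_on V E" by (metis VV inj_onI)
  with E(2) have "(\<lambda>e. (norm (conj_op T e))\<^sup>2) summable_on V ` E"
    by (simp add: summable_on_reindex o_def)
  with orthonormal_basis_image[OF sa involution E(1)] show ?thesis
    unfolding hilbert_schmidt_def by blast
qed

lemma conj_op_conj_op: "conj_op (conj_op T) = T"
  by (rule blinfun_eqI) simp

lemma hilbert_schmidt_conj_op_iff: "hilbert_schmidt (conj_op T) \<longleftrightarrow> hilbert_schmidt T"
  using hilbert_schmidt_conj_opI[of T] hilbert_schmidt_conj_opI[of "conj_op T"]
  by (auto simp: conj_op_conj_op)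

end

text \<open>Square roots are computed by \<open>op_sqrt_eqI\<close>, which rests on completeness;
  the algebra above lives on any real inner product space.\<close>

locale symmetry_op_complete = symmetry_op V
  for V :: "'a::{real_inner, complete_space} \<Rightarrow>\<^sub>L 'a"
begin

lemma op_sqrt_conj_op: "positive_op T \<Longrightarrow> op_sqrt (conj_op T) = conj_op (op_sqrt T)"
  by (rule op_sqrt_eqI)
    (simp_all add: positive_op_conj_op positive_op_sqrt conj_op_compose[symmetric] op_sqrt_square)

lemma op_abs_conj_op: "self_adjoint T \<Longrightarrow> op_abs (conj_op T) = conj_op (op_abs T)"
  by (rule op_abs_eqI)
    (simp_all add: self_adjoint_conj_op positive_op_conj_op positive_op_abs
      conj_op_compose[symmetric] op_abs_square)

lemma trace_class_conj_opI:
  assumes "self_adjoint T" "trace_class T"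
  shows "trace_class (conj_op T)"
proof -
  from assms obtain E where E: "orthonormal_basis E" "(\<lambda>e. op_abs T e \<bullet> e) summable_on E"
    by (auto simp: trace_class_def)
  have "inj_on V E" by (metis VV inj_onI)
  with E(2) have "(\<lambda>e. op_abs (conj_op T) e \<bullet> e) summable_on V ` E"
    by (simp add: summable_on_reindex o_def op_abs_conj_op assms(1) inner_V)
  with orthonormal_basis_image[OF sa involution E(1)] show ?thesis
    unfolding trace_class_def by blast
qed

lemma trace_class_conj_op_iff:
  "self_adjoint T \<Longrightarrow> trace_class (conj_op T) \<longleftrightarrow> trace_class T"
  using trace_class_conj_opI[of T] trace_class_conj_opI[of "conj_op T"]
  by (auto simp: conj_op_conj_op self_adjoint_conj_op)

end

section \<open>Sum and difference coordinates, and the symplectic operator\<close>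

definition hadamard_op :: "('a::real_normed_vector \<times> 'a) \<Rightarrow>\<^sub>L ('a \<times> 'a)" where
  "hadamard_op = (1 / sqrt 2) *\<^sub>R block_op id_blinfun id_blinfun id_blinfun (- id_blinfun)"

lemma hadamard_op_apply: "hadamard_op (x, y) = ((1 / sqrt 2) *\<^sub>R (x + y), (1 / sqrt 2) *\<^sub>R (x - y))"
  by (simp add: hadamard_op_def blinfun.scaleR_left blinfun.minus_left)

lemma symmetry_op_hadamard_op: "symmetry_op hadamard_op"
proof
  show "self_adjoint (hadamard_op :: ('a::real_inner \<times> 'a) \<Rightarrow>\<^sub>L ('a \<times> 'a))"
    by (simp add: self_adjoint_def split_paired_all hadamard_op_apply inner_simps algebra_simps)
  show "hadamard_op o\<^sub>L hadamard_op = (id_blinfun :: ('a::real_inner \<times> 'a) \<Rightarrow>\<^sub>L ('a \<times> 'a))"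
    by (rule blinfun_eqI)
      (auto simp: split_paired_all hadamard_op_apply scaleR_add_right[symmetric]
        scaleR_diff_right[symmetric] scaleR_2[symmetric] simp del: scaleR_add_right scaleR_diff_right)
qed

lemma symmetry_op_complete_hadamard_op:
  "symmetry_op_complete (hadamard_op :: ('a::{real_inner, complete_space} \<times> 'a) \<Rightarrow>\<^sub>L ('a \<times> 'a))"
  by (simp add: symmetry_op_complete_def symmetry_op_hadamard_op)

text \<open>The block operator preserves the vectors \<open>(x, x)\<close>, acting there as
  \<open>A + B\<close>, and the vectors \<open>(x, - x)\<close>, acting there as
  \<open>A - B\<close>.\<close>

lemma block_op_eq_conj_op:
  fixes A B :: "'a::real_inner \<Rightarrow>\<^sub>L 'a"
  shows "block_op A B B A = symmetry_op.conj_op hadamard_op (diag_op (A + B) (A - B))"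
proof (rule blinfun_eqI)
  interpret symmetry_op "hadamard_op :: ('a \<times> 'a) \<Rightarrow>\<^sub>L ('a \<times> 'a)"
    by (rule symmetry_op_hadamard_op)
  fix z :: "'a \<times> 'a"
  obtain x y where z: "z = (x, y)" by (cases z)
  have half: "(1/2) *\<^sub>R (u + w + (u + w)) = u + w" for u w :: 'a
    by (metis field_sum_of_halves mult_1 scaleR_add_left scaleR_add_right scaleR_one)
  have "block_op A B B A (x, y) = (1/2) *\<^sub>R (A x + B y + (A x + B y), B x + A y + (B x + A y))"
    by (simp add: half)
  also have "\<dots> = conj_op (diag_op (A + B) (A - B)) (x, y)"
    by (simp add: hadamard_op_apply blinfun.bilinear_simps scaleR_diff_right scaleR_add_right)
  finally show "block_op A B B A z = conj_op (diag_op (A + B) (A - B)) z" by (simp add: z)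
qed

lemma J_op_apply: "J_op (x, y) = (y, - x)"
  by (simp add: J_op_def blinfun.minus_left)

lemma inner_J_op: "J_op s \<bullet> t = - (s \<bullet> J_op t)"
  by (cases s; cases t) (simp add: J_op_apply inner_commute)

lemma inner_J_op_self: "J_op s \<bullet> s = 0"
  by (cases s) (simp add: J_op_apply inner_commute)

text \<open>\<open>J_op\<close> is a quarter turn of the two coordinates and
  \<open>hadamard_op\<close> a reflection; conjugating a rotation by a reflection inverts it, and
  the inverse of \<open>J_op\<close> is \<open>- J_op\<close>.\<close>

lemma conj_op_J_op: "symmetry_op.conj_op hadamard_op J_op = - (J_op :: ('a::real_inner \<times> 'a) \<Rightarrow>\<^sub>L _)"
proof (rule blinfun_eqI)
  interpret symmetry_op "hadamard_op :: ('a \<times> 'a) \<Rightarrow>\<^sub>L ('a \<times> 'a)"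
    by (rule symmetry_op_hadamard_op)
  fix z :: "'a \<times> 'a"
  obtain x y where z: "z = (x, y)" by (cases z)
  have half: "(1/2) *\<^sub>R u + (1/2) *\<^sub>R u = u" for u :: 'a
    by (metis field_sum_of_halves mult_1 scaleR_add_left scaleR_one)
  show "conj_op J_op z = (- J_op) z"
    using half[of x] half[of y]
    by (simp add: z hadamard_op_apply J_op_apply blinfun.bilinear_simps scaleR_diff_right
        scaleR_add_right algebra_simps)
qed

section \<open>The positivity condition as an inequality of real quadratic forms\<close>

lemma cpositive_complexify_diff_J_iff:
  assumes "self_adjoint S"
  shows "cpositive (complexify S - (cmult \<i> o\<^sub>L complexify J_op))
    \<longleftrightarrow> (\<forall>s t. 0 \<le> S s \<bullet> s + S t \<bullet> t + 2 * (J_op t \<bullet> s))"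
proof -
  \<comment> \<open>At \<open>s + i t\<close> the operator \<open>- i J\<close> gives
    \<open>J t - i J s\<close>; antisymmetry of \<open>J\<close> makes the two real cross terms
    equal, whence the factor 2.\<close>
  have "Re (cinner ((complexify S - (cmult \<i> o\<^sub>L complexify J_op)) (s, t)) (s, t))
      = S s \<bullet> s + S t \<bullet> t + 2 * (J_op t \<bullet> s)" for s t
    using inner_J_op[of s t]
    by (simp add: cinner_def blinfun.diff_left inner_simps inner_commute)
  moreover have "Im (cinner ((complexify S - (cmult \<i> o\<^sub>L complexify J_op)) (s, t)) (s, t)) = 0" for s t
    using self_adjointD[OF assms, of s t] inner_J_op_self[of s] inner_J_op_self[of t]
    by (simp add: cinner_def blinfun.diff_left inner_simps inner_commute)
  ultimately show ?thesis by (simp add: cpositive_def split_paired_all)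
qed

text \<open>With \<open>s = (a, b)\<close> and \<open>t = (c, d)\<close> the inequality decouples
  into one for \<open>(a, d)\<close> and one for \<open>(b, c)\<close>. The second is the first
  evaluated at \<open>- c\<close> and \<open>b\<close>, so a single inequality in two vectors
  remains.\<close>

lemma cpositive_conj_op_diff_J_iff:
  fixes P Q :: "'a::real_inner \<Rightarrow>\<^sub>L 'a"
  assumes "self_adjoint P" "self_adjoint Q"
  shows "cpositive (complexify (symmetry_op.conj_op hadamard_op (diag_op P Q))
      - (cmult \<i> o\<^sub>L complexify J_op))
    \<longleftrightarrow> (\<forall>a d. 2 * (a \<bullet> d) \<le> P a \<bullet> a + Q d \<bullet> d)" (is "?L \<longleftrightarrow> ?R")
proof -
  interpret symmetry_op "hadamard_op :: ('a \<times> 'a) \<Rightarrow>\<^sub>L ('a \<times> 'a)"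
    by (rule symmetry_op_hadamard_op)
  let ?V = "hadamard_op :: ('a \<times> 'a) \<Rightarrow>\<^sub>L ('a \<times> 'a)"
  let ?D = "diag_op P Q"
  have VJV: "?V (J_op (?V t)) = - J_op t" for t
    using conj_op_apply[of J_op t] by (simp add: conj_op_J_op blinfun.minus_left)
  have "?L \<longleftrightarrow> (\<forall>s t. 0 \<le> conj_op ?D s \<bullet> s + conj_op ?D t \<bullet> t + 2 * (J_op t \<bullet> s))"
    using assms by (intro cpositive_complexify_diff_J_iff self_adjoint_conj_op self_adjoint_diag_op)
  \<comment> \<open>\<open>V\<close> is a bijection, so \<open>s\<close> and \<open>t\<close> may
    range over its values.\<close>
  also have "\<dots> \<longleftrightarrow> (\<forall>s t. 0 \<le> conj_op ?D (?V s) \<bullet> ?V s + conj_op ?D (?V t) \<bullet> ?V t + 2 * (J_op (?V t) \<bullet> ?V s))"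
    by (metis VV)
  also have "\<dots> \<longleftrightarrow> (\<forall>s t. 0 \<le> ?D s \<bullet> s + ?D t \<bullet> t - 2 * (J_op t \<bullet> s))"
  proof -
    have "J_op (?V t) \<bullet> ?V s = - (J_op t \<bullet> s)" for s t
      using VJV[of t] inner_V[of "J_op (?V t)" s] by simp
    then show ?thesis by (simp add: inner_V)
  qed
  also have "\<dots> \<longleftrightarrow> (\<forall>a b c d. 2 * (a \<bullet> d) - 2 * (b \<bullet> c) \<le> P a \<bullet> a + Q b \<bullet> b + (P c \<bullet> c + Q d \<bullet> d))"
    by (simp add: split_paired_all J_op_apply inner_commute algebra_simps)
  also have "\<dots> \<longleftrightarrow> ?R"
  proof
    assume *: "\<forall>a b c d. 2 * (a \<bullet> d) - 2 * (b \<bullet> c) \<le> P a \<bullet> a + Q b \<bullet> b + (P c \<bullet> c + Q d \<bullet> d)"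
    show ?R
    proof (intro allI)
      fix a d show "2 * (a \<bullet> d) \<le> P a \<bullet> a + Q d \<bullet> d"
        using *[rule_format, of a d 0 0] by simp
    qed
  next
    assume R: ?R
    show "\<forall>a b c d. 2 * (a \<bullet> d) - 2 * (b \<bullet> c) \<le> P a \<bullet> a + Q b \<bullet> b + (P c \<bullet> c + Q d \<bullet> d)"
    proof (intro allI)
      fix a b c d
      show "2 * (a \<bullet> d) - 2 * (b \<bullet> c) \<le> P a \<bullet> a + Q b \<bullet> b + (P c \<bullet> c + Q d \<bullet> d)"
        using R[rule_format, of a d] R[rule_format, of "- c" b]
        by (simp add: blinfun.minus_right inner_commute)
    qed
  qed
  finally show ?thesis .
qed

section \<open>Inverses and the order of quadratic forms\<close>

lemma is_op_inverse_unique: "is_op_inverse T R \<Longrightarrow> is_op_inverse T R' \<Longrightarrow> R = R'"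
  unfolding is_op_inverse_def blinfun_eq_iff by simp metis

lemma op_inverse_eqI: "is_op_inverse T R \<Longrightarrow> op_inverse T = R"
  unfolding op_inverse_def by (blast intro: the_equality is_op_inverse_unique)

lemma is_op_inverse_complexify: "is_op_inverse T R \<Longrightarrow> is_op_inverse (complexify T) (complexify R)"
  by (simp add: is_op_inverse_def blinfun_eq_iff split_paired_all)

lemma self_adjoint_inverse:
  assumes "self_adjoint T" "is_op_inverse T R"
  shows "self_adjoint R"
  unfolding self_adjoint_def
proof (intro allI)
  fix x y
  have TR: "T (R z) = z" for z using assms(2) by (simp add: is_op_inverse_def blinfun_eq_iff)
  show "R x \<bullet> y = x \<bullet> R y" using self_adjointD[OF assms(1), of "R x" "R y"] by (simp add: TR)
qed

text \<open>The Hermitian form of a complexified self-adjoint operator at \<open>x + i y\<close> is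
  the sum of the real forms at \<open>x\<close> and \<open>y\<close>.\<close>

lemma cop_le_complexify_iff:
  assumes "self_adjoint R" "self_adjoint P"
  shows "cop_le (complexify R) (complexify P) \<longleftrightarrow> (\<forall>x. R x \<bullet> x \<le> P x \<bullet> x)"
proof -
  have Re: "Re (cinner ((complexify P - complexify R) (x, y)) (x, y))
      = (P x \<bullet> x - R x \<bullet> x) + (P y \<bullet> y - R y \<bullet> y)" for x y
    by (simp add: cinner_def blinfun.diff_left inner_simps)
  have Im: "Im (cinner ((complexify P - complexify R) (x, y)) (x, y)) = 0" for x y
    using self_adjointD[OF assms(1), of x y] self_adjointD[OF assms(2), of x y]
    by (simp add: cinner_def blinfun.diff_left inner_simps inner_commute)
  have "cop_le (complexify R) (complexify P)
      \<longleftrightarrow> (\<forall>x y. 0 \<le> (P x \<bullet> x - R x \<bullet> x) + (P y \<bullet> y - R y \<bullet> y))"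
    unfolding cop_le_def cpositive_def split_paired_All Re Im by simp
  also have "\<dots> \<longleftrightarrow> (\<forall>x. R x \<bullet> x \<le> P x \<bullet> x)"
  proof
    assume *: "\<forall>x y. 0 \<le> (P x \<bullet> x - R x \<bullet> x) + (P y \<bullet> y - R y \<bullet> y)"
    show "\<forall>x. R x \<bullet> x \<le> P x \<bullet> x"
    proof
      fix x show "R x \<bullet> x \<le> P x \<bullet> x" using *[rule_format, of x 0] by simp
    qed
  next
    assume *: "\<forall>x. R x \<bullet> x \<le> P x \<bullet> x"
    show "\<forall>x y. 0 \<le> (P x \<bullet> x - R x \<bullet> x) + (P y \<bullet> y - R y \<bullet> y)"
    proof (intro allI)
      fix x y show "0 \<le> (P x \<bullet> x - R x \<bullet> x) + (P y \<bullet> y - R y \<bullet> y)"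
        using *[rule_format, of x] *[rule_format, of y] by linarith
    qed
  qed
  finally show ?thesis .
qed

lemma inverse_form_le_iff:
  fixes P Q R :: "'a::real_inner \<Rightarrow>\<^sub>L 'a"
  assumes Q: "positive_op Q" and R: "is_op_inverse Q R"
  shows "(\<forall>x. R x \<bullet> x \<le> P x \<bullet> x) \<longleftrightarrow> (\<forall>a d. 2 * (a \<bullet> d) \<le> P a \<bullet> a + Q d \<bullet> d)"
proof
  have QR: "Q (R z) = z" for z
    using R by (simp add: is_op_inverse_def blinfun_eq_iff)
  { assume *: "\<forall>x. R x \<bullet> x \<le> P x \<bullet> x"
    show "\<forall>a d. 2 * (a \<bullet> d) \<le> P a \<bullet> a + Q d \<bullet> d"
    proof (intro allI)
      fix a d
      \<comment> \<open>The vector \<open>R a\<close> minimises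
        \<open>Q d \<bullet> d - 2 * (a \<bullet> d)\<close> over \<open>d\<close>; this completes
        the square around it. The converse inserts the minimiser itself.\<close>
      have "0 \<le> Q (d - R a) \<bullet> (d - R a)" using Q by (rule positive_opD)
      also have "\<dots> = Q d \<bullet> d - Q d \<bullet> R a - a \<bullet> d + a \<bullet> R a"
        by (simp add: blinfun.bilinear_simps QR inner_simps)
      also have "Q d \<bullet> R a = d \<bullet> a"
        using self_adjointD[OF positive_opD(1)[OF Q], of d "R a"] by (simp add: QR)
      finally show "2 * (a \<bullet> d) \<le> P a \<bullet> a + Q d \<bullet> d"
        using *[rule_format, of a] by (simp add: inner_commute)
    qed }
  { assume *: "\<forall>a d. 2 * (a \<bullet> d) \<le> P a \<bullet> a + Q d \<bullet> d"
    show "\<forall>x. R x \<bullet> x \<le> P x \<bullet> x"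
    proof
      fix x show "R x \<bullet> x \<le> P x \<bullet> x"
        using *[rule_format, of x "R x"] by (simp add: QR inner_commute)
    qed }
qed

text \<open>\<open>K\<close> inherits antisymmetry from \<open>J_op\<close>, so
  \<open>op_adjoint K\<close> composed with \<open>K\<close> is \<open>- K K\<close>. As
  \<open>J_op\<close> swaps the two components, \<open>D J D\<close> for
  \<open>D = diag_op p q\<close> has off-diagonal blocks \<open>p q\<close> and
  \<open>- q p\<close>; its square has diagonal blocks \<open>- p Q p\<close> and
  \<open>- q P q\<close>, and both equal \<open>- P Q\<close>.\<close>

lemma op_adjoint_sqrt_J_sqrt:
  fixes P Q :: "'a::{real_inner, complete_space} \<Rightarrow>\<^sub>L 'a"
  assumes P: "positive_op P" and Q: "positive_op Q" and comm: "P o\<^sub>L Q = Q o\<^sub>L P"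
  defines "S \<equiv> symmetry_op.conj_op hadamard_op (diag_op P Q)"
  defines "K \<equiv> op_sqrt S o\<^sub>L J_op o\<^sub>L op_sqrt S"
  shows "op_adjoint K o\<^sub>L K = symmetry_op.conj_op hadamard_op (diag_op (P o\<^sub>L Q) (P o\<^sub>L Q))"
proof -
  interpret symmetry_op_complete "hadamard_op :: ('a \<times> 'a) \<Rightarrow>\<^sub>L ('a \<times> 'a)"
    by (rule symmetry_op_complete_hadamard_op)
  let ?V = "hadamard_op :: ('a \<times> 'a) \<Rightarrow>\<^sub>L ('a \<times> 'a)"
  define p q where "p = op_sqrt P" and "q = op_sqrt Q"
  have pp: "p (p x) = P x" and qq: "q (q x) = Q x" for x
    using op_sqrt_square[OF P] op_sqrt_square[OF Q]
    by (metis blinfun_apply_blinfun_compose p_def q_def)+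
  \<comment> \<open>A root of \<open>P\<close> commutes with whatever commutes with
    \<open>P\<close>, and likewise for \<open>Q\<close>.\<close>
  have PQ: "P (Q x) = Q (P x)" and Pq: "P (q x) = q (P x)" and Qp: "Q (p x) = p (Q x)" for x
    using comm op_sqrt_commute[OF P comm[symmetric]] op_sqrt_commute[OF Q comm]
    by (metis blinfun_apply_blinfun_compose p_def q_def)+
  let ?D = "diag_op p q"
  have sqrtS: "op_sqrt S = conj_op ?D"
    by (simp add: S_def op_sqrt_conj_op op_sqrt_diag_op positive_op_diag_op P Q p_def q_def)
  have saS: "self_adjoint (op_sqrt S)"
    unfolding S_def by (intro positive_opD(1) positive_op_sqrt positive_op_conj_op positive_op_diag_op P Q)
  have adj: "op_adjoint K = - K"
    by (rule op_adjoint_eqI) (simp add: K_def self_adjointD[OF saS] inner_J_op blinfun.minus_left)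
  have VJV: "?V (J_op (?V t)) = - J_op t" for t
    using conj_op_apply[of J_op t] by (simp add: conj_op_J_op blinfun.minus_left)
  have K: "K z = - ?V (?D (J_op (?D (?V z))))" for z
    by (simp add: K_def sqrtS VJV blinfun.minus_right)
  have DJD: "?D (J_op (?D (?D (J_op (?D (x, y)))))) = (- P (Q x), - P (Q y))" for x y
    by (simp add: J_op_apply blinfun.minus_right pp qq Pq Qp PQ)
  show ?thesis
  proof (rule blinfun_eqI)
    fix z
    obtain x y where xy: "?V z = (x, y)" by (cases "?V z")
    have "(op_adjoint K o\<^sub>L K) z = - ?V (?D (J_op (?D (?D (J_op (?D (?V z)))))))"
      by (simp add: adj K blinfun.minus_left blinfun.minus_right)
    also have "\<dots> = ?V (P (Q x), P (Q y))"
      unfolding xy DJD by (simp add: blinfun.minus_right[symmetric])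
    also have "\<dots> = conj_op (diag_op (P o\<^sub>L Q) (P o\<^sub>L Q)) z"
      by (simp add: xy)
    finally show "(op_adjoint K o\<^sub>L K) z = conj_op (diag_op (P o\<^sub>L Q) (P o\<^sub>L Q)) z" .
  qed
qed

section \<open>Assembling the equivalence\<close>

lemma op_invertible_diag_op:
  assumes "op_invertible P" "op_invertible Q"
  shows "op_invertible (diag_op P Q)"
proof -
  obtain P' Q' where "is_op_inverse P P'" "is_op_inverse Q Q'"
    using assms by (auto simp: op_invertible_def)
  then have "is_op_inverse (diag_op P Q) (diag_op P' Q')"
    by (simp add: is_op_inverse_def diag_op_compose diag_op_id)
  then show ?thesis by (auto simp: op_invertible_def)
qed

theorem theorem12:
  fixes A B :: "'a::{real_inner, complete_space, second_countable_topology} \<Rightarrow>\<^sub>L 'a"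
  assumes "self_adjoint A" and "self_adjoint B"
    and "positive_invertible (A + B)" and "positive_invertible (A - B)"
    and "(A + B) o\<^sub>L (A - B) = (A - B) o\<^sub>L (A + B)"
  shows "gaussian_covariance_operator (block_op A B B A) \<longleftrightarrow>
    cop_le (op_inverse (complexify (A - B))) (complexify (A + B)) \<and>
    (hilbert_schmidt (A + B - id_blinfun) \<and> hilbert_schmidt (A - B - id_blinfun)) \<and>
    trace_class ((A o\<^sub>L A) - (B o\<^sub>L B) - id_blinfun)"
proof -
  interpret symmetry_op_complete "hadamard_op :: ('a \<times> 'a) \<Rightarrow>\<^sub>L ('a \<times> 'a)"
    by (rule symmetry_op_complete_hadamard_op)
  define P Q where "P = A + B" and "Q = A - B"
  have P: "positive_op P" "op_invertible P" and Q: "positive_op Q" "op_invertible Q"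
    using assms(3,4) positive_invertible_positive_op positive_invertible_op_invertible
    by (auto simp: P_def Q_def)
  have saP: "self_adjoint P" and saQ: "self_adjoint Q" using P Q positive_opD(1) by auto
  have comm: "P o\<^sub>L Q = Q o\<^sub>L P" using assms(5) by (simp add: P_def Q_def)
  have PQ: "P o\<^sub>L Q = (A o\<^sub>L A) - (B o\<^sub>L B)"
  proof (rule blinfun_eqI)
    fix x
    \<comment> \<open>Comparing the two products of \<open>A + B\<close> and \<open>A - B\<close>
      leaves only mixed terms, so \<open>A\<close> and \<open>B\<close> commute and the mixed terms
      of \<open>P Q\<close> cancel.\<close>
    have "2 *\<^sub>R A (B x) = 2 *\<^sub>R B (A x)"
      using arg_cong[OF comm, of "\<lambda>T. blinfun_apply T x"]
      by (simp add: P_def Q_def blinfun.bilinear_simps scaleR_2 algebra_simps)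
    then have "A (B x) = B (A x)" by simp
    then show "(P o\<^sub>L Q) x = ((A o\<^sub>L A) - (B o\<^sub>L B)) x"
      by (simp add: P_def Q_def blinfun.bilinear_simps)
  qed
  have saPQ: "self_adjoint ((P o\<^sub>L Q) - id_blinfun)"
    by (intro self_adjoint_diff self_adjoint_compose self_adjoint_id saP saQ comm)
  obtain R where R: "is_op_inverse Q R" using Q(2) by (auto simp: op_invertible_def)
  have S: "block_op A B B A = conj_op (diag_op P Q)"
    by (simp add: block_op_eq_conj_op P_def Q_def)
  \<comment> \<open>Symmetry and invertibility hold outright, so the equivalence reduces to matching
    the three conditions one by one.\<close>
  have "self_adjoint (block_op A B B A)"
    unfolding S by (intro self_adjoint_conj_op self_adjoint_diag_op saP saQ)
  moreover have "op_invertible (block_op A B B A)"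
    unfolding S by (intro op_invertible_conj_op op_invertible_diag_op P Q)
  moreover have "cpositive (complexify (block_op A B B A) - (cmult \<i> o\<^sub>L complexify J_op))
      \<longleftrightarrow> cop_le (op_inverse (complexify Q)) (complexify P)"
    unfolding S cpositive_conj_op_diff_J_iff[OF saP saQ]
      op_inverse_eqI[OF is_op_inverse_complexify[OF R]]
      cop_le_complexify_iff[OF self_adjoint_inverse[OF saQ R] saP]
      inverse_form_le_iff[OF Q(1) R] ..
  moreover have "hilbert_schmidt (block_op A B B A - id_blinfun)
      \<longleftrightarrow> hilbert_schmidt (P - id_blinfun) \<and> hilbert_schmidt (Q - id_blinfun)"
  proof -
    \<comment> \<open>The identity is its own conjugate and is block diagonal, so subtracting it
      passes inside the conjugation to both blocks.\<close>
    have "block_op A B B A - id_blinfun = conj_op (diag_op (P - id_blinfun) (Q - id_blinfun))"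
      by (simp add: S conj_op_diff conj_op_id diag_op_id flip: diag_op_diff)
    then show ?thesis
      by (simp add: hilbert_schmidt_conj_op_iff hilbert_schmidt_diag_op_iff
          self_adjoint_diff saP saQ self_adjoint_id)
  qed
  moreover have "trace_class
      ((op_adjoint (op_sqrt (block_op A B B A) o\<^sub>L J_op o\<^sub>L op_sqrt (block_op A B B A)) o\<^sub>L
        (op_sqrt (block_op A B B A) o\<^sub>L J_op o\<^sub>L op_sqrt (block_op A B B A))) - id_blinfun)
      \<longleftrightarrow> trace_class ((P o\<^sub>L Q) - id_blinfun)"
  proof -
    have "conj_op (diag_op (P o\<^sub>L Q) (P o\<^sub>L Q)) - id_blinfun
        = conj_op (diag_op ((P o\<^sub>L Q) - id_blinfun) ((P o\<^sub>L Q) - id_blinfun))"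
      by (simp add: conj_op_diff conj_op_id diag_op_id flip: diag_op_diff)
    then show ?thesis
      unfolding S op_adjoint_sqrt_J_sqrt[OF P(1) Q(1) comm]
      by (simp add: trace_class_conj_op_iff trace_class_diag_op_iff self_adjoint_diag_op saPQ)
  qed
  ultimately show ?thesis
    unfolding gaussian_covariance_operator_def Let_def PQ[symmetric] P_def[symmetric] Q_def[symmetric]
    by blast
qed

end
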